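(* Let $\Bbbk$ be a field of characteristic $2$, $R=\Bbbk[x,t,y_1,y_2,y_3,z_1,z_2,z_3]$ with the standard grading, and let $$I=(xz_1-y_2y_3,\ xz_2-y_1y_3,\ xz_3-y_1y_2,\ ty_1-z_2z_3,\ ty_2-z_1z_3,\ ty_3-z_1z_2,\ xt-y_1z_1,\ xt-y_2z_2,\ xt-y_3z_3)\subset R.$$ Let $Q=\{xy_i^2z_i^2t:1\le i\le3\}$, let $O_1,\dots,O_5$ be the orbits defined in the context, let $S\subset Q$ be a subset of odd cardinality, and set $$H_{0,S}=\sum_{u\in S}u+\sum_{i=1}^5\sum_{u\in O_i}u.$$ Consider the minimal graded free resolution of $R/I$ as an $R$-module $$F_\bullet:\quad0\to R(-6)\to R(-4)^9\to R(-3)^{16}\to R(-2)^9\to R$$ and its second Frobenius power $$\varphi^*F_\bullet:\quad0\to R(-12)\to R(-8)^9\to R(-6)^{16}\to R(-4)^9\to R.$$ Then there exists a chain map $\Phi^\flat_\bullet\colon\varphi^*F_\bullet\to F_\bullet$ such that $\Phi_0^\flat$ is the identity map and $\Phi_4^\flat\colon\varphi^*F_4\cong R(-12)\to R(-6)\cong F_4$ is multiplication by $H_{0,S}$.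
   Context: The group $G=\mathfrak{S}_3\times\mathbb{Z}/(2)$ acts on $R$ by $\Bbbk$-algebra automorphisms as follows: for every $\sigma\in\mathfrak{S}_3$ and both values of $[m]\in\mathbb{Z}/(2)$, $(\sigma,[m])\cdot y_i=y_{\sigma(i)}$ and $(\sigma,[m])\cdot z_i=z_{\sigma(i)}$; moreover $(\sigma,[0])\cdot x=x$, $(\sigma,[0])\cdot t=t$, $(\sigma,[1])\cdot x=t$, $(\sigma,[1])\cdot t=x$. For $1\le i\le5$, $O_i$ is the $G$-orbit of $\eta_i$, where $$\eta_1=y_1y_2y_3z_1z_2z_3,\quad\eta_2=xy_1y_2z_1z_2t,\quad\eta_3=xy_1z_1^2z_2z_3,\quad\eta_4=x^2z_1z_2z_3t,\quad\eta_5=x^2y_1z_1t^2;$$ these orbits have $1,3,6,2,3$ elements respectively. The set $Q$ is the $G$-orbit of $xy_1^2z_1^2t$. The ideal $I$ is the homogeneous ideal of the Segre embedding of $\mathbb{P}^1\times\mathbb{P}^1\times\mathbb{P}^1$ in $\mathbb{P}^7$, a codimension $4$ Gorenstein ideal. The second Frobenius power $\varphi^*F_\bullet$ is obtained from $F_\bullet$ by squaring all entries of the matrices of the differentials; the identifications of $F_4$ and $\varphi^*F_4$ with shifts of $R$ use a basis of $F_4$ and the induced basis of $\varphi^*F_4$.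
   Formalization: The action of [1] is corrected: it exchanges x with t and also y_i with z_i, so (σ,[1])·y_i = z_σ(i) and (σ,[1])·z_i = y_σ(i); with the action as printed, [1] does not preserve I and the claim is false. This changes the orbits O_3 and O_4. *)

theory Defs
  imports
    "HOL-Library.Poly_Mapping"
    "HOL-Computational_Algebra.Polynomial"
    "Jordan_Normal_Form.Matrix"
    "Jordan_Normal_Form.Matrix_Kernel"
begin

datatype idx = I1 | I2 | I3

datatype var = VX | VT | VY idx | VZ idx

text \<open>Polynomials are finitely supported functions from monomials (exponent vectors) to
  coefficients, with the convolution product of \<^theory>\<open>HOL-Library.Poly_Mapping\<close>.\<close>

type_synonym 'k R = "(var \<Rightarrow>\<^sub>0 nat) \<Rightarrow>\<^sub>0 'k"

definition Const :: "'k \<Rightarrow> 'k::field R" where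
  "Const c = Poly_Mapping.single 0 c"

definition Var :: "var \<Rightarrow> 'k::field R" where
  "Var v = Poly_Mapping.single (Poly_Mapping.single v 1) 1"

abbreviation X :: "'k::field R" where "X \<equiv> Var VX"
abbreviation T :: "'k::field R" where "T \<equiv> Var VT"
abbreviation Y :: "idx \<Rightarrow> 'k::field R" where "Y i \<equiv> Var (VY i)"
abbreviation Z :: "idx \<Rightarrow> 'k::field R" where "Z i \<equiv> Var (VZ i)"

definition mdeg :: "(var \<Rightarrow>\<^sub>0 nat) \<Rightarrow> nat" where
  "mdeg m = (\<Sum>v\<in>Poly_Mapping.keys m. Poly_Mapping.lookup m v)"

definition homogeneous :: "nat \<Rightarrow> 'k::field R \<Rightarrow> bool" where
  "homogeneous n p \<longleftrightarrow> (\<forall>m\<in>Poly_Mapping.keys p. mdeg m = n)"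

definition segre_gens :: "'k::field R set" where
  "segre_gens =
    {X * Z I1 - Y I2 * Y I3, X * Z I2 - Y I1 * Y I3, X * Z I3 - Y I1 * Y I2,
     T * Y I1 - Z I2 * Z I3, T * Y I2 - Z I1 * Z I3, T * Y I3 - Z I1 * Z I2,
     X * T - Y I1 * Z I1, X * T - Y I2 * Z I2, X * T - Y I3 * Z I3}"

definition segre_ideal :: "'k::field R set" where
  "segre_ideal = module.span (*) segre_gens"

text \<open>The \<open>'k\<close>-algebra endomorphism sending each variable \<open>v\<close> to \<open>f v\<close>.\<close>

definition subst :: "(var \<Rightarrow> 'k::field R) \<Rightarrow> 'k R \<Rightarrow> 'k R" where
  "subst f p = (\<Sum>m\<in>Poly_Mapping.keys p.
     Const (Poly_Mapping.lookup p m) *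
     (\<Prod>v\<in>Poly_Mapping.keys m. f v ^ Poly_Mapping.lookup m v))"

text \<open>An element of the group is a pair of a permutation of the three indices and a class
  modulo 2, with \<^const>\<open>True\<close> for the nonzero class. The nonzero class exchanges \<open>x\<close> with \<open>t\<close>
  and also \<open>y\<^sub>i\<close> with \<open>z\<^sub>i\<close>: this is the symmetry of the Segre variety that reverses the cube
  whose vertices are the eight variables. Exchanging only \<open>x\<close> and \<open>t\<close> would not preserve the
  ideal.\<close>

definition G :: "((idx \<Rightarrow> idx) \<times> bool) set" where
  "G = {\<sigma>. bij \<sigma>} \<times> UNIV"

fun act_var :: "(idx \<Rightarrow> idx) \<times> bool \<Rightarrow> var \<Rightarrow> var" where
  "act_var (\<sigma>, m) VX = (if m then VT else VX)"
| "act_var (\<sigma>, m) VT = (if m then VX else VT)"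
| "act_var (\<sigma>, m) (VY i) = (if m then VZ (\<sigma> i) else VY (\<sigma> i))"
| "act_var (\<sigma>, m) (VZ i) = (if m then VY (\<sigma> i) else VZ (\<sigma> i))"

definition act :: "(idx \<Rightarrow> idx) \<times> bool \<Rightarrow> 'k::field R \<Rightarrow> 'k R" where
  "act g = subst (\<lambda>v. Var (act_var g v))"

definition orbit :: "'k::field R \<Rightarrow> 'k R set" where
  "orbit p = (\<lambda>g. act g p) ` G"

definition etas :: "'k::field R list" where
  "etas =
    [Y I1 * Y I2 * Y I3 * Z I1 * Z I2 * Z I3,
     X * Y I1 * Y I2 * Z I1 * Z I2 * T,
     X * Y I1 * Z I1 ^ 2 * Z I2 * Z I3,
     X ^ 2 * Z I1 * Z I2 * Z I3 * T,
     X ^ 2 * Y I1 * Z I1 * T ^ 2]"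

definition Q :: "'k::field R set" where
  "Q = {X * Y i ^ 2 * Z i ^ 2 * T | i. True}"

definition H0 :: "'k::field R set \<Rightarrow> 'k R" where
  "H0 S = (\<Sum>u\<in>S. u) + (\<Sum>\<eta>\<leftarrow>etas. \<Sum>u\<in>orbit \<eta>. u)"

text \<open>A list \<open>[a\<^sub>1, \<dots>, a\<^sub>n]\<close> stands for the graded free module \<open>R(-a\<^sub>1) \<oplus> \<dots> \<oplus> R(-a\<^sub>n)\<close>,
  whose elements are the vectors of length \<open>n\<close>; the \<open>j\<close>-th standard basis vector has degree
  \<open>a\<^sub>j\<close>. A degree-preserving map has entries that vanish or have degree \<open>a\<^sub>j - b\<^sub>i\<close>.\<close>

definition graded_map :: "nat list \<Rightarrow> nat list \<Rightarrow> 'k::field R mat \<Rightarrow> bool" where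
  "graded_map as bs A \<longleftrightarrow>
     A \<in> carrier_mat (length bs) (length as) \<and>
     (\<forall>i<length bs. \<forall>j<length as.
        \<forall>m\<in>Poly_Mapping.keys (A $$ (i, j)). bs ! i + mdeg m = as ! j)"

definition mat_image :: "'k::field R mat \<Rightarrow> 'k R vec set" where
  "mat_image A = (\<lambda>v. A *\<^sub>v v) ` carrier_vec (dim_col A)"

text \<open>A family \<open>F\<close> of shifts and a family \<open>d\<close> of matrices, with \<open>d i\<close> the differential from
  the \<open>i\<close>-th to the \<open>(i - 1)\<close>-st module for \<open>i \<ge> 1\<close>; the value \<open>d 0\<close> is irrelevant. The
  augmentation is the projection of \<open>R\<close> onto \<open>R/I\<close>. Modules beyond the length of the
  resolution are zero, represented by the empty list. In the minimality condition the
  constant term of an entry is its coefficient at the monomial 0.\<close>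

definition graded_free_resolution ::
  "'k::field R set \<Rightarrow> (nat \<Rightarrow> nat list) \<Rightarrow> (nat \<Rightarrow> 'k R mat) \<Rightarrow> bool" where
  "graded_free_resolution I F d \<longleftrightarrow>
     F 0 = [0] \<and>
     (\<forall>i. graded_map (F (Suc i)) (F i) (d (Suc i))) \<and>
     mat_image (d 1) = {v \<in> carrier_vec 1. v $ 0 \<in> I} \<and>
     (\<forall>i. mat_kernel (d (Suc i)) = mat_image (d (Suc (Suc i))))"

definition minimal_graded_free_resolution ::
  "'k::field R set \<Rightarrow> (nat \<Rightarrow> nat list) \<Rightarrow> (nat \<Rightarrow> 'k R mat) \<Rightarrow> bool" where
  "minimal_graded_free_resolution I F d \<longleftrightarrow>
     graded_free_resolution I F d \<and>
     (\<forall>i. \<forall>r<length (F i). \<forall>c<length (F (Suc i)).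
        Poly_Mapping.lookup (d (Suc i) $$ (r, c)) 0 = 0)"

definition segre_shifts :: "nat \<Rightarrow> nat list" where
  "segre_shifts i =
    (if i = 0 then [0]
     else if i = 1 then replicate 9 2
     else if i = 2 then replicate 16 3
     else if i = 3 then replicate 9 4
     else if i = 4 then [6]
     else [])"

definition frob_shifts :: "(nat \<Rightarrow> nat list) \<Rightarrow> nat \<Rightarrow> nat list" where
  "frob_shifts F i = map (\<lambda>a. 2 * a) (F i)"

definition frob_diff :: "(nat \<Rightarrow> 'k::field R mat) \<Rightarrow> nat \<Rightarrow> 'k R mat" where
  "frob_diff d i = map_mat (\<lambda>p. p ^ 2) (d i)"

definition graded_chain_map ::
  "(nat \<Rightarrow> nat list) \<Rightarrow> (nat \<Rightarrow> 'k::field R mat) \<Rightarrow>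
   (nat \<Rightarrow> nat list) \<Rightarrow> (nat \<Rightarrow> 'k R mat) \<Rightarrow> (nat \<Rightarrow> 'k R mat) \<Rightarrow> bool" where
  "graded_chain_map F d F' d' \<Phi> \<longleftrightarrow>
     (\<forall>i. graded_map (F i) (F' i) (\<Phi> i)) \<and>
     (\<forall>i. \<Phi> i * d (Suc i) = d' (Suc i) * \<Phi> (Suc i))"

text \<open>A basis vector of degree \<open>a\<close> of \<open>R(-a)\<close>, with \<open>R(-a)\<close> regarded as the vectors of
  length 1: its entry is homogeneous of degree 0.\<close>

definition homogeneous_basis_vec :: "'k::field R vec \<Rightarrow> bool" where
  "homogeneous_basis_vec e \<longleftrightarrow>
     e \<in> carrier_vec 1 \<and> homogeneous 0 (e $ 0) \<and>
     (\<forall>v\<in>carrier_vec 1. \<exists>!r. v = r \<cdot>\<^sub>v e)"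

text \<open>If \<open>e\<close> is an element of a free module given in coordinates, its image in the Frobenius
  twist is given by the squares of the coordinates.\<close>

definition frob_vec :: "'k::field R vec \<Rightarrow> 'k R vec" where
  "frob_vec e = map_vec (\<lambda>p. p ^ 2) e"

end

theory Submission
  imports Defs
begin

text \<open>The idea is to write down one complex of the right shape, with one chain map from its
  Frobenius twist, and to carry both over to the given minimal resolution \<open>d\<close>.

  Since \<open>d\<close> is exact, the identity of the ring lifts to a map from the explicit complex
  \<open>segre_diff\<close> to \<open>d\<close>. In each position both complexes are generated in the same degree, so that
  the map can be given by square matrices of constants (\<open>lift_constants\<close>). They are injective on
  constant vectors because the columns of each explicit differential are linearly independent
  over the field, hence they are invertible (\<open>constant_iso_of_complexes\<close>); in this way the
  exactness of \<open>segre_diff\<close> is a consequence of that of \<open>d\<close>. If \<open>B\<close> is this isomorphism and \<open>A\<close> the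
  explicit chain map, then \<open>B A \<phi>(B\<inverse>)\<close>, with \<open>\<phi>\<close> squaring the entries, is a chain map for \<open>d\<close>
  (\<open>transport_square\<close>); here characteristic 2 makes \<open>\<phi>\<close> multiplicative on matrices. In the last
  position \<open>B\<close> is a nonzero constant \<open>b\<close>, and \<open>b\<close> is also the basis in which the last map becomes
  multiplication by \<open>H0 S\<close>.

  The explicit chain map starts with the diagonal matrix of the quadrics themselves, as each of
  them divides its square. The others solve linear equations over the field with two elements;
  that they fit is checked by expanding (\<open>lift2_square\<close>, \<open>lift3_square\<close>, \<open>lift4_square\<close>). The
  freedom in \<open>S\<close> is a homotopy: the last map may be changed by combinations of the
  squares of the quadrics, and the monomials of \<open>Q\<close> differ from \<open>x\<^sup>3t\<^sup>3\<close> by \<open>xt(xt - y\<^sub>iz\<^sub>i)\<^sup>2\<close>. An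
  odd number of them is therefore congruent to a single \<open>x\<^sup>3t\<^sup>3\<close>.\<close>

section \<open>Graded polynomials\<close>

lemma UNIV_idx: "(UNIV :: idx set) = {I1, I2, I3}"
  using idx.exhaust by auto

lemma UNIV_var: "(UNIV :: var set) = {VX, VT, VY I1, VY I2, VY I3, VZ I1, VZ I2, VZ I3}"
proof -
  have "v \<in> {VX, VT, VY I1, VY I2, VY I3, VZ I1, VZ I2, VZ I3}" for v
  proof (cases v)
    case (VY i)
    then show ?thesis by (cases i) simp_all
  next
    case (VZ i)
    then show ?thesis by (cases i) simp_all
  qed simp_all
  then show ?thesis by blast
qed

lemma finite_var [simp]: "finite (A :: var set)"
  by (rule finite_subset[OF subset_UNIV]) (simp add: UNIV_var)

lemma mdeg_eq_sum_UNIV: "mdeg m = (\<Sum>v\<in>UNIV. Poly_Mapping.lookup m v)"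
  unfolding mdeg_def by (rule sum.mono_neutral_left) (auto simp: in_keys_iff)

lemma mdeg_add: "mdeg (m + n) = mdeg m + mdeg n"
  by (simp add: mdeg_eq_sum_UNIV lookup_add sum.distrib)

lemma mdeg_eq_0_iff: "mdeg m = 0 \<longleftrightarrow> m = 0"
  by (auto simp: mdeg_eq_sum_UNIV intro!: poly_mapping_eqI)

lemma mdeg_single: "mdeg (Poly_Mapping.single v n) = n"
  by (simp add: mdeg_def)

lemma homogeneous_0 [simp]: "homogeneous n 0"
  by (simp add: homogeneous_def)

lemma homogeneous_add: "homogeneous n p \<Longrightarrow> homogeneous n q \<Longrightarrow> homogeneous n (p + q)"
  using keys_add[of p q] unfolding homogeneous_def by blast

lemma homogeneous_sum: "(\<And>i. i \<in> A \<Longrightarrow> homogeneous n (f i)) \<Longrightarrow> homogeneous n (sum f A)"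
  by (induction A rule: infinite_finite_induct) (auto intro: homogeneous_add)

lemma homogeneous_mult: "homogeneous m p \<Longrightarrow> homogeneous n q \<Longrightarrow> homogeneous (m + n) (p * q)"
  using keys_mult[of p q] unfolding homogeneous_def by (fastforce simp: mdeg_add)

lemma homogeneous_Const [simp]: "homogeneous 0 (Const c)"
  by (simp add: homogeneous_def Const_def mdeg_eq_0_iff)

lemma homogeneous_Var: "homogeneous 1 (Var v)"
  by (simp add: homogeneous_def Var_def mdeg_single)

interpretation Const: semiring_hom Const
  by unfold_locales (simp_all add: Const_def single_add mult_single)

lemma lookup_Const_0 [simp]: "Poly_Mapping.lookup (Const c) 0 = c"
  by (simp add: Const_def)

lemma lookup_mult_Const: "Poly_Mapping.lookup (p * Const c) m = Poly_Mapping.lookup p m * c"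
proof -
  have "p * Const c = Poly_Mapping.map ((*) c) p"
    by (simp add: Const_def mult_map_scale_conv_mult mult.commute)
  then show ?thesis
    by (simp add: map.rep_eq when_def mult.commute)
qed

text \<open>A monomial of degree \<open>k\<close> in the product of a form of degree \<open>k\<close> with any polynomial can only
  come from the constant term of the second factor.\<close>

lemma lookup_homogeneous_mult:
  assumes "homogeneous k p" "mdeg m = k"
  shows "Poly_Mapping.lookup (p * q) m = Poly_Mapping.lookup p m * Poly_Mapping.lookup q 0"
proof -
  define r where "r = q - Const (Poly_Mapping.lookup q 0)"
  have "Poly_Mapping.lookup (p * r) m = 0"
  proof (rule ccontr)
    assume "Poly_Mapping.lookup (p * r) m \<noteq> 0"
    then obtain a b where ab: "m = a + b" "a \<in> Poly_Mapping.keys p" "b \<in> Poly_Mapping.keys r"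
      using keys_mult[of p r] by (auto simp: in_keys_iff)
    have "mdeg a = k" using ab assms by (auto simp: homogeneous_def)
    then have "b = 0" using ab assms by (simp add: mdeg_add mdeg_eq_0_iff)
    then show False using ab by (simp add: in_keys_iff r_def lookup_minus)
  qed
  moreover have "p * q = p * Const (Poly_Mapping.lookup q 0) + p * r"
    by (simp add: r_def algebra_simps)
  ultimately show ?thesis by (simp add: lookup_add lookup_mult_Const)
qed

section \<open>Matrices of forms\<close>

definition homogeneous_mat :: "nat \<Rightarrow> 'k::field R mat \<Rightarrow> bool" where
  "homogeneous_mat k A \<longleftrightarrow> (\<forall>i<dim_row A. \<forall>j<dim_col A. homogeneous k (A $$ (i, j)))"

lemma homogeneous_mat_mult:
  assumes "homogeneous_mat k A" "homogeneous_mat l B" "dim_col A = dim_row B"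
  shows "homogeneous_mat (k + l) (A * B)"
  using assms unfolding homogeneous_mat_def
  by (auto simp: scalar_prod_def intro!: homogeneous_sum homogeneous_mult)

lemma homogeneous_mat_Const: "homogeneous_mat 0 (map_mat Const B)"
  by (simp add: homogeneous_mat_def)

lemma graded_map_replicate:
  assumes "b \<le> a"
  shows "graded_map (replicate n a) (replicate r b) A \<longleftrightarrow>
    A \<in> carrier_mat r n \<and> homogeneous_mat (a - b) A"
  using assms unfolding graded_map_def homogeneous_mat_def homogeneous_def by fastforce

text \<open>If a form is a combination of forms of the same degree, replacing the coefficients by their
  constant terms gives the same form. So a lift along a map of graded modules may be taken to have
  constant entries as soon as source and target of the lift are generated in the same degrees.\<close>

lemma lift_constants:
  fixes A C :: "'k::field R mat"
  assumes A: "A \<in> carrier_mat r n" "homogeneous_mat k A"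
    and C: "C \<in> carrier_mat r s" "homogeneous_mat k C"
    and image: "\<And>j. j < s \<Longrightarrow> col C j \<in> mat_image A"
  obtains B where "B \<in> carrier_mat n s" "A * map_mat Const B = C"
proof -
  have "\<forall>j. \<exists>v. j < s \<longrightarrow> v \<in> carrier_vec n \<and> A *\<^sub>v v = col C j"
    using image A by (fastforce simp: mat_image_def)
  then obtain V where V: "\<And>j. j < s \<Longrightarrow> V j \<in> carrier_vec n"
      "\<And>j. j < s \<Longrightarrow> A *\<^sub>v V j = col C j"
    by metis
  define B where "B = mat n s (\<lambda>(l, j). Poly_Mapping.lookup (V j $ l) 0)"
  have "A * map_mat Const B = C"
  proof (rule eq_matI)
    fix i j assume "i < dim_row C" "j < dim_col C"
    then have ij: "i < r" "j < s" using C by auto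
    have hA: "homogeneous k (A $$ (i, l))" if "l < n" for l
      using A that ij by (auto simp: homogeneous_mat_def)
    have e1: "(A * map_mat Const B) $$ (i, j) = (\<Sum>l<n. A $$ (i, l) * Const (B $$ (l, j)))"
      using ij A by (simp add: scalar_prod_def B_def atLeast0LessThan)
    have "C $$ (i, j) = (A *\<^sub>v V j) $ i" using V(2)[OF ij(2)] ij C by simp
    also have "\<dots> = (\<Sum>l<n. A $$ (i, l) * V j $ l)"
      using ij A V(1)[OF ij(2)] by (simp add: scalar_prod_def atLeast0LessThan)
    finally have e2: "C $$ (i, j) = (\<Sum>l<n. A $$ (i, l) * V j $ l)" .
    show "(A * map_mat Const B) $$ (i, j) = C $$ (i, j)"
    proof (rule poly_mapping_eqI)
      fix m
      show "Poly_Mapping.lookup ((A * map_mat Const B) $$ (i, j)) m =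
        Poly_Mapping.lookup (C $$ (i, j)) m"
      proof (cases "mdeg m = k")
        case True
        show ?thesis unfolding e1 e2 lookup_sum
          using True ij
          by (auto intro!: sum.cong simp: lookup_homogeneous_mult[OF hA] B_def lookup_mult_Const)
      next
        case False
        have "homogeneous k (C $$ (i, j))" using C ij by (auto simp: homogeneous_mat_def)
        moreover have "homogeneous (k + 0) ((A * map_mat Const B) $$ (i, j))"
          unfolding e1 by (intro homogeneous_sum homogeneous_mult hA homogeneous_Const) simp
        ultimately show ?thesis using False
          by (metis add_0_right homogeneous_def in_keys_iff)
      qed
    qed
  qed (use A C in \<open>auto simp: B_def\<close>)
  moreover have "B \<in> carrier_mat n s" by (simp add: B_def)
  ultimately show ?thesis using that by blast
qed

lemma trivial_kernel_imp_inverse: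
  fixes B :: "'a::field mat"
  assumes B: "B \<in> carrier_mat n n"
    and ker: "\<And>v. v \<in> carrier_vec n \<Longrightarrow> B *\<^sub>v v = 0\<^sub>v n \<Longrightarrow> v = 0\<^sub>v n"
  obtains C where "C \<in> carrier_mat n n" "B * C = 1\<^sub>m n" "C * B = 1\<^sub>m n"
proof -
  have "det B \<noteq> 0"
    using det_0_iff_vec_prod_zero_field[OF B] ker by blast
  from det_non_zero_imp_unit[OF B this, unfolded Units_def, of "()"] show ?thesis
    using that by (auto simp: ring_mat_def)
qed

text \<open>The columns are linearly independent over the ground field, though in general not over the
  polynomial ring.\<close>

definition constants_independent :: "'k::field R mat \<Rightarrow> bool" where
  "constants_independent D \<longleftrightarrow> (\<forall>v\<in>carrier_vec (dim_col D).
     D *\<^sub>v map_vec Const v = 0\<^sub>v (dim_row D) \<longrightarrow> v = 0\<^sub>v (dim_col D))"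

text \<open>An isomorphism of free modules that is given by constants lifts to the next free modules, and
  the lift is again invertible: a constant vector \<open>v\<close> killed by the lift \<open>B'\<close> satisfies
  \<open>B D v = d B' v = 0\<close>, hence \<open>D v = 0\<close>, and then \<open>v = 0\<close> since the columns of \<open>D\<close> are independent
  over the field. As \<open>B'\<close> is square, a trivial kernel suffices.\<close>

lemma extend_constant_iso:
  fixes d D :: "'k::field R mat"
  assumes d: "d \<in> carrier_mat r n" "homogeneous_mat k d"
    and D: "D \<in> carrier_mat r n" "homogeneous_mat k D" "constants_independent D"
    and B: "B \<in> carrier_mat r r" "C \<in> carrier_mat r r" "C * B = 1\<^sub>m r"
    and image: "\<And>j. j < n \<Longrightarrow> col (map_mat Const B * D) j \<in> mat_image d"
  obtains B' C' where "B' \<in> carrier_mat n n" "C' \<in> carrier_mat n n"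
    "B' * C' = 1\<^sub>m n" "C' * B' = 1\<^sub>m n" "d * map_mat Const B' = map_mat Const B * D"
proof -
  have BD: "map_mat Const B * D \<in> carrier_mat r n" using B D by auto
  have "homogeneous_mat (0 + k) (map_mat Const B * D)"
    using B D by (intro homogeneous_mat_mult homogeneous_mat_Const) auto
  then obtain B' where B': "B' \<in> carrier_mat n n" "d * map_mat Const B' = map_mat Const B * D"
    using lift_constants[OF d BD _ image] by auto
  have CB: "map_mat Const C * map_mat Const B = 1\<^sub>m r"
    using B by (metis Const.mat_hom_mult Const.mat_hom_one)
  have "v = 0\<^sub>v n" if v: "v \<in> carrier_vec n" "B' *\<^sub>v v = 0\<^sub>v n" for v
  proof -
    let ?v = "map_vec Const v"
    have v': "?v \<in> carrier_vec n" using v by simp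
    have Dv: "D *\<^sub>v ?v \<in> carrier_vec r" using D v' by auto
    have "map_mat Const B' *\<^sub>v ?v = 0\<^sub>v n"
      using v B' by (metis Const.mult_mat_vec_hom Const.vec_hom_zero)
    then have "(map_mat Const B * D) *\<^sub>v ?v = d *\<^sub>v 0\<^sub>v n"
      using d B' v' by (metis assoc_mult_mat_vec map_carrier_mat)
    then have "map_mat Const B *\<^sub>v (D *\<^sub>v ?v) = 0\<^sub>v r"
      using d B D v' by (auto simp: assoc_mult_mat_vec[where n\<^sub>2=r] intro!: eq_vecI)
    then have "map_mat Const C *\<^sub>v (map_mat Const B *\<^sub>v (D *\<^sub>v ?v)) = 0\<^sub>v r"
      using B by (auto intro!: eq_vecI)
    then have "(map_mat Const C * map_mat Const B) *\<^sub>v (D *\<^sub>v ?v) = 0\<^sub>v r"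
      using B Dv by (simp add: assoc_mult_mat_vec[where n\<^sub>2=r])
    then have "D *\<^sub>v ?v = 0\<^sub>v r" using CB Dv by simp
    then show ?thesis using D v by (auto simp: constants_independent_def)
  qed
  with trivial_kernel_imp_inverse[OF B'(1)] that[OF B'(1) _ _ _ B'(2)] show ?thesis by blast
qed

text \<open>The lifting step of the comparison theorem: exactness of \<open>c\<close>, \<open>d\<close> and \<open>C D = 0\<close> put the columns
  of \<open>U D\<close> into the image of \<open>d\<close>.\<close>

lemma col_in_image_next:
  fixes c d :: "'k::field R mat"
  assumes c: "c \<in> carrier_mat q r" and exact: "mat_kernel c = mat_image d"
    and U: "U \<in> carrier_mat r r" "V \<in> carrier_mat q q" "c * U = V * C"
    and CD: "C \<in> carrier_mat q r" "D \<in> carrier_mat r n" "C * D = 0\<^sub>m q n"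
    and j: "j < n"
  shows "col (U * D) j \<in> mat_image d"
proof -
  have "c * (U * D) = (c * U) * D" by (rule assoc_mult_mat[OF c U(1) CD(2), symmetric])
  also have "\<dots> = V * (C * D)" unfolding U(3) by (rule assoc_mult_mat[OF U(2) CD(1,2)])
  also have "\<dots> = 0\<^sub>m q n" using U CD by simp
  finally have 0: "c * (U * D) = 0\<^sub>m q n" .
  have "c *\<^sub>v col (U * D) j = col (c * (U * D)) j"
    using col_mult2[OF c, of "U * D" n j] U CD j by auto
  also have "\<dots> = 0\<^sub>v q" using 0 j by auto
  finally have "col (U * D) j \<in> mat_kernel c"
    using c U CD j by (intro mat_kernelI[OF c]) (auto intro!: col_carrier_vec mult_carrier_mat)
  then show ?thesis using exact by simp
qed

text \<open>Conjugating a chain map between the \<open>f\<close>-twist of the complex \<open>D\<close> and \<open>D\<close> by an isomorphism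
  \<open>U\<close> from \<open>D\<close> to \<open>d\<close>: on the source side the inverse \<open>V\<close> has to be twisted too.\<close>

lemma transport_square:
  fixes f :: "'a::comm_ring_1 \<Rightarrow> 'a"
  assumes "semiring_hom f"
    and d: "d \<in> carrier_mat r n" and D: "D \<in> carrier_mat r n"
    and U: "U \<in> carrier_mat r r" "V \<in> carrier_mat r r" "V * U = 1\<^sub>m r"
    and U': "U' \<in> carrier_mat n n" "V' \<in> carrier_mat n n" "U' * V' = 1\<^sub>m n"
    and A: "A \<in> carrier_mat r r" "A' \<in> carrier_mat n n"
    and dU: "d * U' = U * D" and square: "A * map_mat f D = D * A'"
  shows "(U * A * map_mat f V) * map_mat f d = d * (U' * A' * map_mat f V')"
proof -
  interpret semiring_hom f by fact
  have fV: "map_mat f V \<in> carrier_mat r r" and fV': "map_mat f V' \<in> carrier_mat n n"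
    and fd: "map_mat f d \<in> carrier_mat r n" and fD: "map_mat f D \<in> carrier_mat r n"
    using U U' d D by simp_all
  note UA = mult_carrier_mat[OF U(1) A(1)] and UA' = mult_carrier_mat[OF U'(1) A(2)]
    and UD = mult_carrier_mat[OF U(1) D] and DV = mult_carrier_mat[OF D U'(2)]
  have "V * d = V * (d * (U' * V'))" unfolding U'(3) using d by simp
  also have "\<dots> = V * ((U * D) * V')"
    unfolding dU[symmetric] assoc_mult_mat[OF d U'(1,2)] ..
  also have "\<dots> = (V * U) * (D * V')"
    unfolding assoc_mult_mat[OF U(1) D U'(2)] assoc_mult_mat[OF U(2,1) DV] ..
  also have "\<dots> = D * V'" unfolding U(3) by (rule left_mult_one_mat[OF DV])
  finally have Vd: "V * d = D * V'" .
  have "(U * A * map_mat f V) * map_mat f d = (U * A) * (map_mat f V * map_mat f d)"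
    by (rule assoc_mult_mat[OF UA fV fd])
  also have "map_mat f V * map_mat f d = map_mat f D * map_mat f V'"
    unfolding mat_hom_mult[OF U(2) d, symmetric] mat_hom_mult[OF D U'(2), symmetric] Vd ..
  also have "(U * A) * (map_mat f D * map_mat f V') = (U * A) * map_mat f D * map_mat f V'"
    by (rule assoc_mult_mat[OF UA fD fV', symmetric])
  also have "(U * A) * map_mat f D = U * (D * A')"
    unfolding square[symmetric] by (rule assoc_mult_mat[OF U(1) A(1) fD])
  also have "\<dots> = (U * D) * A'"
    by (rule assoc_mult_mat[OF U(1) D A(2), symmetric])
  also have "\<dots> = d * (U' * A')"
    unfolding dU[symmetric] by (rule assoc_mult_mat[OF d U'(1) A(2)])
  also have "\<dots> * map_mat f V' = d * (U' * A' * map_mat f V')"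
    by (rule assoc_mult_mat[OF d UA' fV'])
  finally show ?thesis .
qed

text \<open>The comparison map is built position by position. The exactness of \<open>d\<close> provides each lift, and
  the independence of the columns of \<open>D\<close> makes it invertible, which in turn is what the next step
  starts from.\<close>

lemma constant_iso_of_complexes:
  fixes d D :: "nat \<Rightarrow> 'k::field R mat" and n k :: "nat \<Rightarrow> nat"
  assumes d: "\<And>i. d (Suc i) \<in> carrier_mat (n i) (n (Suc i))" "\<And>i. homogeneous_mat (k i) (d (Suc i))"
    and exact: "\<And>i. mat_kernel (d (Suc i)) = mat_image (d (Suc (Suc i)))"
    and D: "\<And>i. D (Suc i) \<in> carrier_mat (n i) (n (Suc i))" "\<And>i. homogeneous_mat (k i) (D (Suc i))"
      "\<And>i. constants_independent (D (Suc i))"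
    and complex: "\<And>i. D (Suc i) * D (Suc (Suc i)) = 0\<^sub>m (n i) (n (Suc (Suc i)))"
    and augmented: "\<And>j. j < n 1 \<Longrightarrow> col (D 1) j \<in> mat_image (d 1)"
  obtains B C :: "nat \<Rightarrow> 'k mat" where "B 0 = 1\<^sub>m (n 0)"
    "\<And>i. B i \<in> carrier_mat (n i) (n i)" "\<And>i. C i \<in> carrier_mat (n i) (n i)"
    "\<And>i. B i * C i = 1\<^sub>m (n i)" "\<And>i. C i * B i = 1\<^sub>m (n i)"
    "\<And>i. d (Suc i) * map_mat Const (B (Suc i)) = map_mat Const (B i) * D (Suc i)"
proof -
  define P where "P i BC \<longleftrightarrow> (i = 0 \<longrightarrow> fst BC = 1\<^sub>m (n 0)) \<and>
      fst BC \<in> carrier_mat (n i) (n i) \<and> snd BC \<in> carrier_mat (n i) (n i) \<and>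
      fst BC * snd BC = 1\<^sub>m (n i) \<and> snd BC * fst BC = 1\<^sub>m (n i) \<and>
      (\<forall>j<n (Suc i). col (map_mat Const (fst BC) * D (Suc i)) j \<in> mat_image (d (Suc i)))"
    for i and BC :: "'k mat \<times> 'k mat"
  define Q where "Q i BC BC' \<longleftrightarrow>
      d (Suc i) * map_mat Const (fst BC') = map_mat Const (fst BC) * D (Suc i)"
    for i and BC BC' :: "'k mat \<times> 'k mat"
  have "\<exists>f. \<forall>i. P i (f i) \<and> Q i (f i) (f (Suc i))"
  proof (rule dependent_nat_choice)
    have "map_mat Const (1\<^sub>m (n 0)) * D 1 = D 1"
      using D(1)[of 0] by (simp add: Const.mat_hom_one)
    then have "P 0 (1\<^sub>m (n 0), 1\<^sub>m (n 0))"
      using augmented by (simp add: P_def)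
    then show "\<exists>BC. P 0 BC" ..
  next
    fix BC i assume P: "P i BC"
    obtain B C where BC: "BC = (B, C)" by fastforce
    have B: "B \<in> carrier_mat (n i) (n i)" "C \<in> carrier_mat (n i) (n i)" "C * B = 1\<^sub>m (n i)"
      and im: "\<And>j. j < n (Suc i) \<Longrightarrow> col (map_mat Const B * D (Suc i)) j \<in> mat_image (d (Suc i))"
      using P by (auto simp: P_def BC)
    obtain B' C' where B': "B' \<in> carrier_mat (n (Suc i)) (n (Suc i))"
        "C' \<in> carrier_mat (n (Suc i)) (n (Suc i))"
        "B' * C' = 1\<^sub>m (n (Suc i))" "C' * B' = 1\<^sub>m (n (Suc i))"
        "d (Suc i) * map_mat Const B' = map_mat Const B * D (Suc i)"
      using extend_constant_iso[OF d(1,2) D(1,2,3) B im] by blast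
    have "col (map_mat Const B' * D (Suc (Suc i))) j \<in> mat_image (d (Suc (Suc i)))"
      if "j < n (Suc (Suc i))" for j
      using col_in_image_next[OF d(1) exact _ _ B'(5) D(1) D(1) complex that] B'(1) B(1)
      by simp
    then have "P (Suc i) (B', C') \<and> Q i BC (B', C')"
      using B' by (simp add: P_def Q_def BC)
    then show "\<exists>BC'. P (Suc i) BC' \<and> Q i BC BC'" ..
  qed
  then obtain f where "\<And>i. P i (f i)" "\<And>i. Q i (f i) (f (Suc i))" by blast
  then show ?thesis using that[of "fst \<circ> f" "snd \<circ> f"] by (simp add: P_def Q_def)
qed

section \<open>Monomials\<close>

definition exponent :: "var list \<Rightarrow> (var \<Rightarrow>\<^sub>0 nat)" where
  "exponent vs = (\<Sum>v\<leftarrow>vs. Poly_Mapping.single v 1)"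

definition monomial :: "var list \<Rightarrow> 'k::field R" where
  "monomial vs = (\<Prod>v\<leftarrow>vs. Var v)"

lemma monomial_eq_single: "monomial vs = Poly_Mapping.single (exponent vs) 1"
  by (induction vs) (simp_all add: monomial_def exponent_def Var_def mult_single)

lemma lookup_exponent: "Poly_Mapping.lookup (exponent vs) v = count_list vs v"
  by (induction vs) (auto simp: exponent_def lookup_add lookup_single when_def)

lemma all_var: "(\<forall>v. P v) \<longleftrightarrow> P VX \<and> P VT \<and> P (VY I1) \<and> P (VY I2) \<and> P (VY I3) \<and>
    P (VZ I1) \<and> P (VZ I2) \<and> P (VZ I3)"
proof -
  have "(\<forall>v. P v) \<longleftrightarrow> (\<forall>v\<in>UNIV. P v)" by simp
  then show ?thesis by (simp add: UNIV_var)
qed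

lemma exponent_eq_iff: "exponent vs = exponent ws \<longleftrightarrow> (\<forall>v. count_list vs v = count_list ws v)"
  by (simp add: poly_mapping_eq_iff fun_eq_iff lookup_exponent)

lemma monomial_eq_iff: "(monomial vs :: 'k::field R) = monomial ws \<longleftrightarrow>
    (\<forall>v. count_list vs v = count_list ws v)"
proof -
  have "(monomial vs :: 'k R) = monomial ws \<longleftrightarrow> exponent vs = exponent ws"
    unfolding monomial_eq_single
    by (metis lookup_single_eq lookup_single_not_eq zero_neq_one)
  then show ?thesis by (simp add: exponent_eq_iff)
qed

lemma subst_monomial: "subst f (monomial vs) = (\<Prod>v\<leftarrow>vs. f v)"
proof -
  have "subst f (monomial vs) = (\<Prod>v\<in>Poly_Mapping.keys (exponent vs). f v ^ count_list vs v)"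
    by (simp add: subst_def monomial_eq_single lookup_exponent)
  also have "\<dots> = (\<Prod>v\<in>UNIV. f v ^ count_list vs v)"
    by (rule prod.mono_neutral_left) (auto simp: in_keys_iff lookup_exponent)
  also have "\<dots> = (\<Prod>v\<leftarrow>vs. f v)"
  proof (induction vs)
    case (Cons a vs)
    have "f v ^ count_list (a # vs) v = (if v = a then f v else 1) * f v ^ count_list vs v" for v
      by simp
    then have "(\<Prod>v\<in>UNIV. f v ^ count_list (a # vs) v) =
        (\<Prod>v\<in>UNIV. if v = a then f v else 1) * (\<Prod>v\<in>UNIV. f v ^ count_list vs v)"
      by (simp only: prod.distrib)
    then show ?case using Cons by simp
  qed simp
  finally show ?thesis .
qed

lemma act_monomial: "act g (monomial vs) = monomial (map (act_var g) vs)"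
  unfolding act_def subst_monomial by (simp add: monomial_def o_def)

definition perm :: "idx \<Rightarrow> idx \<Rightarrow> idx \<Rightarrow> idx \<Rightarrow> idx" where
  "perm a b c i = (case i of I1 \<Rightarrow> a | I2 \<Rightarrow> b | I3 \<Rightarrow> c)"

lemma perm_simps [simp]: "perm a b c I1 = a" "perm a b c I2 = b" "perm a b c I3 = c"
  by (simp_all add: perm_def)

lemma bijections_idx: "{\<sigma>. bij \<sigma>} =
  {perm I1 I2 I3, perm I1 I3 I2, perm I2 I1 I3, perm I2 I3 I1, perm I3 I1 I2, perm I3 I2 I1}"
  (is "_ = ?P")
proof (intro equalityI subsetI)
  fix \<sigma> :: "idx \<Rightarrow> idx" assume "\<sigma> \<in> {\<sigma>. bij \<sigma>}"
  then have "\<sigma> I1 \<noteq> \<sigma> I2" "\<sigma> I1 \<noteq> \<sigma> I3" "\<sigma> I2 \<noteq> \<sigma> I3"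
    by (auto dest!: bij_is_inj simp: inj_eq)
  moreover have "\<sigma> = perm (\<sigma> I1) (\<sigma> I2) (\<sigma> I3)"
    by (rule ext) (simp add: perm_def split: idx.split)
  ultimately show "\<sigma> \<in> ?P"
    by (cases "\<sigma> I1"; cases "\<sigma> I2"; cases "\<sigma> I3") simp_all
next
  fix \<sigma> assume "\<sigma> \<in> ?P"
  then have "surj \<sigma>" unfolding surj_def
    by (intro allI, rename_tac i, case_tac i) (auto intro: exI[of _ I1] exI[of _ I2] exI[of _ I3])
  moreover have "finite (UNIV :: idx set)" by (simp add: UNIV_idx)
  ultimately show "\<sigma> \<in> {\<sigma>. bij \<sigma>}"
    using finite_UNIV_surj_inj[of \<sigma>] by (simp add: bij_def)
qed

text \<open>The sums over orbits are sums over sets, so that each monomial counts once. Listing all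
  twelve group elements leaves it to the decidable equality of monomials to discard repetitions.\<close>

lemma orbit_monomial: "orbit (monomial vs) = (\<lambda>g. monomial (map (act_var g) vs)) `
  (\<Union>\<sigma>\<in>{perm I1 I2 I3, perm I1 I3 I2, perm I2 I1 I3, perm I2 I3 I1, perm I3 I1 I2, perm I3 I2 I1}.
    {(\<sigma>, False), (\<sigma>, True)})"
proof -
  have "G = (\<Union>\<sigma>\<in>{\<sigma>. bij \<sigma>}. {(\<sigma>, False), (\<sigma>, True)})"
    by (auto simp: G_def)
  then show ?thesis by (simp add: orbit_def act_monomial bijections_idx)
qed

lemma sum_orbit:
  shows "(\<Sum>u\<in>orbit (monomial [VY I1, VY I2, VY I3, VZ I1, VZ I2, VZ I3]). u) =
    (Y I1 * Y I2 * Y I3 * Z I1 * Z I2 * Z I3 :: 'k::field R)"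
  and "(\<Sum>u\<in>orbit (monomial [VX, VY I1, VY I2, VZ I1, VZ I2, VT]). u) =
    (X * Y I1 * Y I2 * Z I1 * Z I2 * T + X * Y I1 * Y I3 * Z I1 * Z I3 * T +
     X * Y I2 * Y I3 * Z I2 * Z I3 * T :: 'k::field R)"
  and "(\<Sum>u\<in>orbit (monomial [VX, VY I1, VZ I1, VZ I1, VZ I2, VZ I3]). u) =
    (X * Y I1 * Z I1 ^ 2 * Z I2 * Z I3 + X * Y I2 * Z I2 ^ 2 * Z I1 * Z I3 +
     X * Y I3 * Z I3 ^ 2 * Z I1 * Z I2 + T * Z I1 * Y I1 ^ 2 * Y I2 * Y I3 +
     T * Z I2 * Y I2 ^ 2 * Y I1 * Y I3 + T * Z I3 * Y I3 ^ 2 * Y I1 * Y I2 :: 'k::field R)"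
  and "(\<Sum>u\<in>orbit (monomial [VX, VX, VZ I1, VZ I2, VZ I3, VT]). u) =
    (X ^ 2 * Z I1 * Z I2 * Z I3 * T + T ^ 2 * Y I1 * Y I2 * Y I3 * X :: 'k::field R)"
  and "(\<Sum>u\<in>orbit (monomial [VX, VX, VY I1, VZ I1, VT, VT]). u) =
    (X ^ 2 * Y I1 * Z I1 * T ^ 2 + X ^ 2 * Y I2 * Z I2 * T ^ 2 +
     X ^ 2 * Y I3 * Z I3 * T ^ 2 :: 'k::field R)"
  by (simp_all add: orbit_monomial sum.insert_if monomial_eq_iff all_var)
    (simp_all add: monomial_def power2_eq_square mult_ac add_ac)

lemma etas_eq_monomials: "(etas :: 'k::field R list) =
  [monomial [VY I1, VY I2, VY I3, VZ I1, VZ I2, VZ I3],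
   monomial [VX, VY I1, VY I2, VZ I1, VZ I2, VT],
   monomial [VX, VY I1, VZ I1, VZ I1, VZ I2, VZ I3],
   monomial [VX, VX, VZ I1, VZ I2, VZ I3, VT],
   monomial [VX, VX, VY I1, VZ I1, VT, VT]]"
  by (simp add: etas_def monomial_def power2_eq_square mult_ac)

text \<open>The odd cardinality of \<open>S\<close> enters as \<open>e I1 + e I2 + e I3 = 1\<close> in characteristic 2, where \<open>e\<close> is
  the indicator of the indices that occur in \<open>S\<close>.\<close>

lemma sum_subset_Q:
  fixes S :: "'k::field R set"
  assumes char: "(2 :: 'k R) = 0" and S: "S \<subseteq> Q" "odd (card S)"
  obtains e :: "idx \<Rightarrow> 'k R" where "\<And>i. homogeneous 0 (e i)" "e I1 + e I2 + e I3 = 1"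
    "(\<Sum>u\<in>S. u) = e I1 * (X * Y I1 ^ 2 * Z I1 ^ 2 * T) + e I2 * (X * Y I2 ^ 2 * Z I2 ^ 2 * T) +
      e I3 * (X * Y I3 ^ 2 * Z I3 ^ 2 * T)"
proof -
  define q :: "idx \<Rightarrow> 'k R" where "q i = X * Y i ^ 2 * Z i ^ 2 * T" for i
  define J where "J = {i. q i \<in> S}"
  define e :: "idx \<Rightarrow> 'k R" where "e i = Const (of_bool (i \<in> J))" for i
  have "q i = monomial [VX, VY i, VY i, VZ i, VZ i, VT]" for i
    by (simp add: q_def monomial_def power2_eq_square mult_ac)
  then have inj: "inj q"
    by (auto intro!: injI simp: monomial_eq_iff split: if_splits dest: spec[of _ "VY i" for i])
  have SJ: "S = q ` J" using S(1) by (auto simp: J_def Q_def q_def)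
  have fin: "finite (UNIV :: idx set)" by (simp add: UNIV_idx)
  have e_J: "(\<Sum>i\<in>UNIV. e i * f i) = sum f J" for f
  proof -
    have "(\<Sum>i\<in>UNIV. e i * f i) = (\<Sum>i\<in>UNIV. if i \<in> J then f i else 0)"
      by (rule sum.cong) (simp_all add: e_def Const.hom_one Const.hom_zero)
    then show ?thesis using sum.inter_restrict[OF fin, of f J] by simp
  qed
  have "sum id S = sum q J" unfolding SJ using inj
    by (simp add: sum.reindex inj_on_subset)
  then have 1: "(\<Sum>u\<in>S. u) = (\<Sum>i\<in>UNIV. e i * q i)" unfolding e_J by (simp add: id_def)
  have "odd (card J)" using S(2) inj by (simp add: SJ card_image inj_on_subset)
  then have "of_nat (card J) = (1 :: 'k R)" using char
    by (auto elim!: oddE)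
  then have 2: "(\<Sum>i\<in>UNIV. e i * 1) = 1" unfolding e_J by simp
  show ?thesis
    using that[of e] 1 2 by (simp add: UNIV_idx q_def e_def algebra_simps)
qed

section \<open>Matrices given by lists of columns\<close>

text \<open>Matrices are written as lists of columns, so that a product of matrices is a list of linear
  combinations of columns and can be computed by rewriting.\<close>

fun lin_comb :: "nat \<Rightarrow> 'a::semiring_0 list list \<Rightarrow> 'a list \<Rightarrow> 'a list" where
  "lin_comb n (c # cs) (b # bs) = map2 (\<lambda>u v. b * u + v) c (lin_comb n cs bs)"
| "lin_comb n _ _ = replicate n 0"

lemma nth_lin_comb:
  assumes "\<forall>c\<in>set cs. length c = n" "length b = length cs" "i < n"
  shows "lin_comb n cs b ! i = (\<Sum>k<length cs. cs ! k ! i * b ! k :: 'a::comm_ring_1)"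
    and "length (lin_comb n cs b) = n"
proof -
  have "length (lin_comb n cs b) = n \<and> lin_comb n cs b ! i = (\<Sum>k<length cs. cs ! k ! i * b ! k)"
    using assms
  proof (induction cs arbitrary: b)
    case (Cons c cs)
    then obtain a b' where "b = a # b'" by (cases b) auto
    with Cons show ?case by (simp add: sum.lessThan_Suc_shift mult.commute del: sum.lessThan_Suc)
  qed simp
  then show "lin_comb n cs b ! i = (\<Sum>k<length cs. cs ! k ! i * b ! k)"
    "length (lin_comb n cs b) = n" by auto
qed

lemma mult_mat_of_cols_list:
  fixes As Bs :: "'a::comm_ring_1 list list"
  assumes "\<forall>c\<in>set As. length c = n" "\<forall>b\<in>set Bs. length b = m" "length As = m"
  shows "mat_of_cols_list n As * mat_of_cols_list m Bs = mat_of_cols_list n (map (lin_comb n As) Bs)"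
  using assms
  by (intro eq_matI) (auto simp: mat_of_cols_list_def scalar_prod_def nth_lin_comb atLeast0LessThan
      intro!: sum.cong)

lemma map_mat_of_cols_list:
  assumes "\<forall>c\<in>set As. length c = n"
  shows "map_mat f (mat_of_cols_list n As) = mat_of_cols_list n (map (map f) As)"
  using assms by (intro eq_matI) (auto simp: mat_of_cols_list_def)

lemma homogeneous_mat_of_cols_list:
  assumes "\<forall>c\<in>set As. length c = n \<and> (\<forall>p\<in>set c. homogeneous k p)"
  shows "homogeneous_mat k (mat_of_cols_list n As)"
  unfolding homogeneous_mat_def
proof (intro allI impI)
  fix i j
  assume "i < dim_row (mat_of_cols_list n As)" "j < dim_col (mat_of_cols_list n As)"
  then have ij: "i < n" "j < length As" by (simp_all add: mat_of_cols_list_def)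
  then have "As ! j \<in> set As" by simp
  then have "length (As ! j) = n" "\<forall>p\<in>set (As ! j). homogeneous k p" using assms by auto
  then have "homogeneous k (As ! j ! i)" using ij by simp
  then show "homogeneous k (mat_of_cols_list n As $$ (i, j))"
    using ij by (simp add: mat_of_cols_list_def)
qed

lemma carrier_mat_of_cols_list: "length As = m \<Longrightarrow> mat_of_cols_list n As \<in> carrier_mat n m"
  by (simp add: mat_of_cols_list_def)

lemma lookup_monomial_exponent: "Poly_Mapping.lookup (monomial vs) (exponent ws) =
    of_bool (\<forall>v. count_list vs v = count_list ws v)"
  by (simp add: monomial_eq_single lookup_single when_def exponent_eq_iff)

lemma lookup_Var_exponent:
  "Poly_Mapping.lookup (Var a) (exponent ws) = of_bool (\<forall>v. count_list [a] v = count_list ws v)"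
  "Poly_Mapping.lookup (Var a * Var b) (exponent ws) =
    of_bool (\<forall>v. count_list [a, b] v = count_list ws v)"
  using lookup_monomial_exponent[of "[a]" ws] lookup_monomial_exponent[of "[a, b]" ws]
  by (simp_all add: monomial_def)

text \<open>To the \<open>j\<close>-th column belongs a pair of a row and a monomial such that, in this row, the monomial
  occurs in the \<open>j\<close>-th entry with coefficient 1 and in no other entry.\<close>

lemma constants_independent_by_witnesses:
  fixes As :: "'k::field R list list"
  assumes len: "\<forall>c\<in>set As. length c = n" "length ws = length As" "\<forall>w\<in>set ws. fst w < n"
    and ws: "map (\<lambda>(r, vs). map (\<lambda>c. Poly_Mapping.lookup (c ! r) (exponent vs)) As) ws =
      map (\<lambda>j. map (\<lambda>k. of_bool (j = k)) [0..<length As]) [0..<length As]"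
  shows "constants_independent (mat_of_cols_list n As)"
  unfolding constants_independent_def
proof (intro ballI impI)
  let ?D = "mat_of_cols_list n As" and ?N = "length As"
  fix v :: "'k vec"
  assume v: "v \<in> carrier_vec (dim_col ?D)" and "?D *\<^sub>v map_vec Const v = 0\<^sub>v (dim_row ?D)"
  then have 0: "?D *\<^sub>v map_vec Const v = 0\<^sub>v n" and dv: "dim_vec v = ?N"
    by (auto simp: mat_of_cols_list_def)
  have "v $ j = 0" if j: "j < ?N" for j
  proof -
    obtain r vs where rvs: "ws ! j = (r, vs)" by fastforce
    have r: "r < n" using len j rvs by (metis fst_conv nth_mem)
    have delta: "Poly_Mapping.lookup (As ! k ! r) (exponent vs) = of_bool (j = k)" if "k < ?N" for k
      using arg_cong[OF ws, of "\<lambda>l. l ! j ! k"] j that len rvs by simp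
    have "0 = Poly_Mapping.lookup ((?D *\<^sub>v map_vec Const v) $ r) (exponent vs)"
      using 0 r by simp
    also have "(?D *\<^sub>v map_vec Const v) $ r = (\<Sum>k<?N. As ! k ! r * Const (v $ k))"
      using r dv by (auto simp: mat_of_cols_list_def scalar_prod_def atLeast0LessThan intro!: sum.cong)
    also have "Poly_Mapping.lookup \<dots> (exponent vs) = (\<Sum>k<?N. of_bool (j = k) * v $ k)"
      using delta by (auto simp: lookup_sum lookup_mult_Const intro!: sum.cong)
    also have "\<dots> = v $ j" using j by simp
    finally show ?thesis by simp
  qed
  then show "v = 0\<^sub>v (dim_col ?D)" using dv by (auto simp: mat_of_cols_list_def)
qed

section \<open>The Segre cube in characteristic 2\<close>

text \<open>The eight elements sit at the vertices of a cube, with \<open>x\<close> at the origin, \<open>y\<^sub>i\<close> at the \<open>i\<close>-th unit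
  vector, \<open>z\<^sub>i\<close> opposite to \<open>y\<^sub>i\<close> and \<open>t\<close> opposite to \<open>x\<close>. The quadrics are the binomials of the six
  faces (product along one diagonal plus product along the other) and three sums of products
  along long diagonals; the signs are those of characteristic 2.

  The linear relations come from the vertices. Let \<open>v\<close> be a vertex with opposite vertex \<open>v'\<close>,
  neighbours \<open>n\<^sub>1, n\<^sub>2, n\<^sub>3\<close>, and \<open>n\<^sub>i'\<close> opposite to \<open>n\<^sub>i\<close>. The combination
  \<open>v (v v' + n\<^sub>i n\<^sub>i') + n\<^sub>i (v n\<^sub>i' + n\<^sub>j n\<^sub>k) = v\<^sup>2 v' + n\<^sub>1 n\<^sub>2 n\<^sub>3\<close> of quadrics does not depend on \<open>i\<close>, so that
  two directions \<open>i\<close> give one relation and each vertex gives two independent ones. In \<open>syz1\<close> the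
  vertices come in the order \<open>x, y\<^sub>3, y\<^sub>2, z\<^sub>1, y\<^sub>1, z\<^sub>2, z\<^sub>3, t\<close>. The remaining differentials \<open>syz2\<close> and
  \<open>syz3\<close> reflect the first two, the quotient ring being Gorenstein; the entries of \<open>syz3\<close> are the
  quadrics again.

  The matrix \<open>lift1\<close> is diagonal, each quadric being the quotient of its square by itself. The
  columns of \<open>lift2\<close> and \<open>lift3\<close> are solutions of linear systems over the field with two elements,
  one system for each column. The grading of the variables by their position in the cube keeps
  these systems small and the solutions sparse.\<close>

locale cube =
  fixes x t y1 y2 y3 z1 z2 z3 :: "'a::comm_ring_1"
begin

definition quadrics :: "'a list list" where
  "quadrics =
    [[x*z1 + y2*y3],
     [x*z2 + y1*y3],
     [x*z3 + y1*y2],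
     [t*y1 + z2*z3],
     [t*y2 + z1*z3],
     [t*y3 + z1*z2],
     [x*t + y1*z1],
     [x*t + y2*z2],
     [x*t + y3*z3]]"

definition syz1 :: "'a list list" where
  "syz1 =
    [[y1, y2, 0, 0, 0, 0, x, x, 0],
     [y1, 0, y3, 0, 0, 0, x, 0, x],
     [0, z1, 0, 0, 0, x, y3, 0, 0],
     [z2, 0, 0, 0, 0, x, 0, y3, 0],
     [0, 0, z1, 0, x, 0, y2, 0, 0],
     [z3, 0, 0, 0, x, 0, 0, 0, y2],
     [t, 0, 0, 0, 0, y2, 0, z1, 0],
     [t, 0, 0, 0, y3, 0, 0, 0, z1],
     [0, 0, z2, x, 0, 0, 0, y1, 0],
     [0, z3, 0, x, 0, 0, 0, 0, y1],
     [0, t, 0, 0, 0, y1, z2, 0, 0],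
     [0, t, 0, y3, 0, 0, 0, 0, z2],
     [0, 0, t, 0, y1, 0, z3, 0, 0],
     [0, 0, t, y2, 0, 0, 0, z3, 0],
     [0, 0, 0, z1, z2, 0, t, t, 0],
     [0, 0, 0, z1, 0, z3, t, 0, t]]"

definition syz2 :: "'a list list" where
  "syz2 =
    [[z1, z1, y2, 0, y3, 0, x, x, 0, 0, 0, 0, 0, 0, 0, 0],
     [0, z2, 0, y1, 0, 0, 0, 0, y3, 0, x, x, 0, 0, 0, 0],
     [z3, 0, 0, 0, 0, y1, 0, 0, 0, y2, 0, 0, x, x, 0, 0],
     [t, 0, 0, 0, z2, 0, y1, 0, z1, 0, y2, 0, 0, 0, x, 0],
     [0, t, z3, 0, 0, 0, 0, y1, 0, z1, 0, 0, y3, 0, 0, x],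
     [t, t, 0, z3, 0, z2, 0, 0, 0, 0, 0, y2, 0, y3, x, x],
     [0, 0, t, t, 0, 0, 0, z2, 0, 0, 0, z1, 0, 0, y3, 0],
     [0, 0, 0, 0, t, t, z3, 0, 0, 0, 0, 0, 0, z1, 0, y2],
     [0, 0, 0, 0, 0, 0, 0, 0, t, t, z3, 0, z2, 0, y1, y1]]"

definition syz3 :: "'a list list" where
  "syz3 =
    [[t*y1 + z2*z3, t*y2 + z1*z3, t*y3 + z1*z2, x*t + y3*z3, x*t + y2*z2, x*t + y1*z1,
      x*z3 + y1*y2, x*z2 + y1*y3, x*z1 + y2*y3]]"

definition lift1 :: "'a list list" where
  "lift1 =
    [[x*z1 + y2*y3, 0, 0, 0, 0, 0, 0, 0, 0],
     [0, x*z2 + y1*y3, 0, 0, 0, 0, 0, 0, 0],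
     [0, 0, x*z3 + y1*y2, 0, 0, 0, 0, 0, 0],
     [0, 0, 0, t*y1 + z2*z3, 0, 0, 0, 0, 0],
     [0, 0, 0, 0, t*y2 + z1*z3, 0, 0, 0, 0],
     [0, 0, 0, 0, 0, t*y3 + z1*z2, 0, 0, 0],
     [0, 0, 0, 0, 0, 0, x*t + y1*z1, 0, 0],
     [0, 0, 0, 0, 0, 0, 0, x*t + y2*z2, 0],
     [0, 0, 0, 0, 0, 0, 0, 0, x*t + y3*z3]]"

definition lift2 :: "'a list list" where
  "lift2 =
    [[x^2*t + x*y1*z1 + x*y2*z2 + y1*y2*y3, 0, x*y1*y2, x*y1*y2, 0, 0, x^2*y1, 0, 0, 0,
      x^2*y2, 0, 0, 0, 0, 0],
     [x*y1*z1, x^2*t + x*y3*z3 + y1*y2*y3, x*y1*y2, 0, 0, x*y1*y3, x^2*y1, 0, 0, 0, 0, 0,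
      x^2*y3, 0, 0, 0],
     [0, 0, x*t*y3 + x*z1*z2 + y1*y3*z1, 0, 0, 0, 0, 0, 0, 0, x*y3*z1, 0, 0, 0, 0, 0],
     [0, 0, 0, x*t*y3 + x*z1*z2 + y2*y3*z2, 0, 0, x*y3*z2, 0, 0, 0, 0, 0, 0, 0, 0, 0],
     [0, 0, 0, 0, x*t*y2 + x*z1*z3 + y1*y2*z1, 0, 0, 0, 0, 0, 0, 0, x*y2*z1, 0, 0, 0],
     [0, 0, 0, 0, 0, x*t*y2 + x*z1*z3 + y2*y3*z3, 0, x*y2*z3, 0, 0, 0, 0, 0, 0, 0, 0],
     [0, 0, 0, t*y2*z1, 0, 0, x*t*z1 + t*y2*y3 + y2*z1*z2, 0, 0, 0, 0, 0, 0, 0, 0, 0],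
     [0, 0, 0, 0, 0, t*y3*z1, 0, x*t*z1 + t*y2*y3 + y3*z1*z3, 0, 0, 0, 0, 0, 0, 0, 0],
     [0, 0, 0, 0, 0, 0, 0, 0, x*t*y1 + x*z2*z3 + y1*y2*z2, 0, 0, 0, 0, x*y1*z2, 0, 0],
     [0, 0, 0, 0, 0, 0, 0, 0, 0, x*t*y1 + x*z2*z3 + y1*y3*z3, 0, x*y1*z3, 0, 0, 0, 0],
     [0, 0, t*y1*z2, 0, 0, 0, 0, 0, 0, 0, x*t*z2 + t*y1*y3 + y1*z1*z2, 0, 0, 0, 0, 0],
     [0, 0, 0, 0, 0, 0, 0, 0, 0, t*y3*z2, 0, x*t*z2 + t*y1*y3 + y3*z2*z3, 0, 0, 0, 0],
     [0, 0, 0, 0, t*y1*z3, 0, 0, 0, 0, 0, 0, 0, x*t*z3 + t*y1*y2 + y1*z1*z3, 0, 0, 0],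
     [0, 0, 0, 0, 0, 0, 0, 0, t*y2*z3, 0, 0, 0, 0, x*t*z3 + t*y1*y2 + y2*z2*z3, 0, 0],
     [t^3, 0, 0, 0, 0, 0, t^2*y1, 0, 0, 0, t^2*y2, 0, t*z1*z2, t*z1*z2,
      t*y1*z1 + t*y2*z2 + z1*z2*z3, 0],
     [0, t^3, 0, 0, 0, 0, 0, t^2*y1, 0, 0, t*z1*z3, t*z1*z3, t^2*y3, 0, 0,
      t*y1*z1 + t*y3*z3 + z1*z2*z3]]"

definition lift3 :: "'a list list" where
  "lift3 =
    [[x^2*t*z1 + x*t*y2*y3 + x*y2*z1*z2 + x*y3*z1*z3 + y1*y2*y3*z1, x*y2*z1^2, x*y3*z1^2,
      x*y2*y3*z1, x*y2*y3*z1, 0, x^2*y2*z1, x^2*y3*z1, 0],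
     [x*y1*z2^2, x^2*t*z2 + x*t*y1*y3 + x*y1*z1*z2 + x*y3*z2*z3 + y1*y2*y3*z2, 0, x*y1*y3*z2,
      0, x*y1*y3*z2, x^2*y1*z2, 0, x^2*y3*z2],
     [0, 0, x^2*t*z3 + x*t*y1*y2 + x*y1*z1*z3 + x*y2*z2*z3 + y1*y2*y3*z3, 0, x*y1*y2*z3,
      x*y1*y2*z3, 0, x^2*y1*z3, x^2*y2*z3],
     [t*y1*y2*z2, t*y1*y2*z1, x*t*z1*z2,
      x*t*y1*z1 + x*t*y2*z2 + x*z1*z2*z3 + t*y1*y2*y3 + y1*y2*z1*z2, 0, 0, x*t*y1*y2,
      x*y1*z1*z2, x*y2*z1*z2],
     [x*t^2*y1 + t*y1*y3*z3, x*t*z1*z3, t*y1*y3*z1, 0,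
      x*t*y1*z1 + x*t*y3*z3 + x*z1*z2*z3 + t*y1*y2*y3 + y1*y3*z1*z3, 0, x*y1*z1*z3,
      x*t*y1*y3, x*y3*z1*z3],
     [x*t*z2*z3, x*t^2*y2 + t*y2*y3*z3, x*t^2*y3 + t*y2*y3*z2, x^2*t^2, x^2*t^2,
      x^2*t^2 + x*t*y2*z2 + x*t*y3*z3 + x*z1*z2*z3 + t*y1*y2*y3 + y2*y3*z2*z3,
      x^2*t*z3 + x*y2*z2*z3, x^2*t*z2 + x*y3*z2*z3, x^2*t*z1 + x*t*y2*y3],
     [t^2*y3*z2, t^2*y3*z1, 0, t^2*y3^2, t*y3*z1*z2, t*y3*z1*z2,
      x*t^2*y3 + x*t*z1*z2 + t*y1*y3*z1 + t*y2*y3*z2 + y3*z1*z2*z3, 0, 0],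
     [t^2*y2*z3, 0, t^2*y2*z1, t*y2*z1*z3, t^2*y2^2, t*y2*z1*z3, 0,
      x*t^2*y2 + x*t*z1*z3 + t*y1*y2*z1 + t*y2*y3*z3 + y2*z1*z2*z3, 0],
     [0, t^2*y1*z3, t^2*y1*z2, t^2*y1^2 + t*y1*z2*z3, t^2*y1^2 + t*y1*z2*z3, 0, t*y1^2*z3,
      t*y1^2*z2, x*t^2*y1 + x*t*z2*z3 + t*y1^2*z1 + t*y1*y2*z2 + t*y1*y3*z3 + y1*z1*z2*z3]]"

text \<open>Together with \<open>lift3\<close> itself goes the form with the orbit sums and \<open>x\<^sup>3t\<^sup>3\<close> at the top. Adding
  to \<open>lift3\<close> the composite of the row \<open>nullhomotopy\<close> with \<open>syz3\<close> adds
  \<open>\<Sum>e\<^sub>ixt(xt + y\<^sub>iz\<^sub>i)\<^sup>2\<close> to that form. If \<open>e1 + e2 + e3 = 1\<close>, this is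
  \<open>x\<^sup>3t\<^sup>3 + \<Sum>e\<^sub>ixty\<^sub>i\<^sup>2z\<^sub>i\<^sup>2\<close> in characteristic 2, so that \<open>x\<^sup>3t\<^sup>3\<close> cancels and \<open>top_form\<close> is left. The
  weights of \<open>nullhomotopy\<close> sit at the entries \<open>xt + y\<^sub>iz\<^sub>i\<close> of \<open>syz3\<close>, which occur there in
  the order \<open>i = 3, 2, 1\<close>.\<close>

definition nullhomotopy :: "'a \<Rightarrow> 'a \<Rightarrow> 'a \<Rightarrow> 'a list" where
  "nullhomotopy e1 e2 e3 = [0, 0, 0, e3*x*t, e2*x*t, e1*x*t, 0, 0, 0]"

definition lift3_shifted :: "'a \<Rightarrow> 'a \<Rightarrow> 'a \<Rightarrow> 'a list list" where
  "lift3_shifted e1 e2 e3 =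
    map2 (\<lambda>s. map2 (\<lambda>q p. p + s * q) (hd syz3)) (nullhomotopy e1 e2 e3) lift3"

definition top_form :: "'a \<Rightarrow> 'a \<Rightarrow> 'a \<Rightarrow> 'a" where
  "top_form e1 e2 e3 = x^2*t^2*y1*z1 + x^2*t^2*y2*z2 + x^2*t^2*y3*z3 + x^2*t*z1*z2*z3 + x*t^2*y1*y2*y3 + x*t*y1*y2*z1*z2 + x*t*y1*y3*z1*z3 + x*t*y2*y3*z2*z3 + x*y1*z1^2*z2*z3 + x*y2*z1*z2^2*z3 + x*y3*z1*z2*z3^2 + t*y1^2*y2*y3*z1 + t*y1*y2^2*y3*z2 + t*y1*y2*y3^2*z3 + y1*y2*y3*z1*z2*z3
    + e1*x*t*y1^2*z1^2 + e2*x*t*y2^2*z2^2 + e3*x*t*y3^2*z3^2"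

lemmas matrix_defs = quadrics_def syz1_def syz2_def syz3_def lift1_def lift2_def lift3_def
  lift3_shifted_def nullhomotopy_def top_form_def

end

text \<open>The identities below hold entry by entry after expansion: once products are sorted, equal
  monomials are adjacent and cancel in pairs.\<close>

locale char2_cube = cube +
  assumes two_zero: "(2::'a) = 0"
begin

lemma double_zero: "(a::'a) + a = 0" "a + (a + b) = (b::'a)"
  using two_zero by (simp_all add: mult_2[symmetric] add.assoc[symmetric])

lemma even_numeral_zero: "(numeral (num.Bit0 m) :: 'a) = 0"
  using two_zero by (simp add: numeral_Bit0 double_zero)

lemmas expand = distrib_left distrib_right mult_ac add_ac double_zero even_numeral_zero
  power2_eq_square power3_eq_cube

lemma quadrics_syz1: "map (lin_comb 1 quadrics) syz1 = replicate 16 [0]"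
  by (simp add: quadrics_def syz1_def numeral_eq_Suc) (simp add: expand)

lemma syz1_syz2: "map (lin_comb 9 syz1) syz2 = replicate 9 (replicate 9 0)"
  by (simp add: syz2_def syz1_def numeral_eq_Suc) (simp add: expand)

lemma syz2_syz3: "map (lin_comb 16 syz2) syz3 = [replicate 16 0]"
  by (simp add: syz2_def syz3_def numeral_eq_Suc) (simp add: expand)

lemma lift1_square: "map (map (\<lambda>p. p^2)) quadrics = map (lin_comb 1 quadrics) lift1"
  by (simp add: quadrics_def lift1_def numeral_eq_Suc power2_eq_square)

lemma lift2_square:
  "map (lin_comb 9 lift1) (map (map (\<lambda>p. p^2)) syz1) = map (lin_comb 9 syz1) lift2"
  by (simp add: lift2_def lift1_def syz1_def numeral_eq_Suc) (simp add: expand)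

lemma lift3_square:
  "map (lin_comb 16 lift2) (map (map (\<lambda>p. p^2)) syz2) =
    map (lin_comb 16 syz2) (lift3_shifted e1 e2 e3)"
  by (simp add: matrix_defs numeral_eq_Suc) (simp add: expand)

lemma lift4_square:
  assumes "e1 + e2 + e3 = 1"
  shows "map (lin_comb 9 (lift3_shifted e1 e2 e3)) (map (map (\<lambda>p. p^2)) syz3) =
    map (lin_comb 9 syz3) [[top_form e1 e2 e3]]"
proof -
  \<comment> \<open>Eliminating one weight makes the identity an unconditional one between polynomials.\<close>
  have e1: "e1 = 1 + e2 + e3"
    using assms by (metis add.assoc add.commute double_zero(2))
  show ?thesis unfolding e1
    by (simp add: matrix_defs numeral_eq_Suc) (simp add: expand)
qed

end

section \<open>Degrees and independence of the explicit matrices\<close>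

interpretation segre: cube X T "Y I1" "Y I2" "Y I3" "Z I1" "Z I2" "Z I3" .

text \<open>Stated with subtraction so that it can be used as a conditional rewrite rule that peels off
  one variable at a time.\<close>

lemma homogeneous_times_Var:
  "0 < n \<Longrightarrow> homogeneous (n - 1) p \<Longrightarrow> homogeneous n (p * Var v)"
  using homogeneous_mult[OF _ homogeneous_Var, of "n - 1" p v] by simp

lemmas homogeneous_simps = homogeneous_add homogeneous_times_Var homogeneous_Var
  homogeneous_Var[unfolded One_nat_def] power2_eq_square power3_eq_cube mult.assoc[symmetric]
  distrib_left

lemma homogeneous_segre:
  "\<forall>c\<in>set segre.quadrics. length c = 1 \<and> (\<forall>p\<in>set c. homogeneous 2 p)"
  "\<forall>c\<in>set segre.syz1. length c = 9 \<and> (\<forall>p\<in>set c. homogeneous 1 p)"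
  "\<forall>c\<in>set segre.syz2. length c = 16 \<and> (\<forall>p\<in>set c. homogeneous 1 p)"
  "\<forall>c\<in>set segre.syz3. length c = 9 \<and> (\<forall>p\<in>set c. homogeneous 2 p)"
  "\<forall>c\<in>set segre.lift1. length c = 9 \<and> (\<forall>p\<in>set c. homogeneous 2 p)"
  "\<forall>c\<in>set segre.lift2. length c = 16 \<and> (\<forall>p\<in>set c. homogeneous 3 p)"
  by (simp_all add: segre.matrix_defs homogeneous_simps)

lemma homogeneous_segre_shifted:
  assumes "homogeneous 0 e1" "homogeneous 0 e2" "homogeneous 0 e3"
  shows "\<forall>c\<in>set (segre.lift3_shifted e1 e2 e3). length c = 9 \<and> (\<forall>p\<in>set c. homogeneous 4 p)"
    and "homogeneous 6 (segre.top_form e1 e2 e3)"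
  using assms by (simp_all add: segre.matrix_defs homogeneous_simps)

lemma constants_independent_segre:
  "constants_independent (mat_of_cols_list 1 segre.quadrics)"
  "constants_independent (mat_of_cols_list 9 segre.syz1)"
  "constants_independent (mat_of_cols_list 16 segre.syz2)"
  "constants_independent (mat_of_cols_list 9 segre.syz3)"
  subgoal by (rule constants_independent_by_witnesses[where ws =
      "[(0, [VY I2, VY I3]), (0, [VY I1, VY I3]), (0, [VY I1, VY I2]), (0, [VZ I2, VZ I3]), (0, [VZ I1, VZ I3]), (0, [VZ I1, VZ I2]), (0, [VY I1, VZ I1]), (0, [VY I2, VZ I2]), (0, [VY I3, VZ I3])]"])
    (simp_all add: segre.matrix_defs upt_rec lookup_add lookup_Var_exponent all_var)
  subgoal by (rule constants_independent_by_witnesses[where ws =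
      "[(1, [VY I2]), (2, [VY I3]), (1, [VZ I1]), (0, [VZ I2]), (2, [VZ I1]), (0, [VZ I3]), (5, [VY I2]), (4, [VY I3]), (2, [VZ I2]), (1, [VZ I3]), (5, [VY I1]), (3, [VY I3]), (4, [VY I1]), (3, [VY I2]), (4, [VZ I2]), (5, [VZ I3])]"])
    (simp_all add: segre.matrix_defs upt_rec lookup_add lookup_Var_exponent all_var)
  subgoal by (rule constants_independent_by_witnesses[where ws =
      "[(0, [VZ I1]), (1, [VZ I2]), (0, [VZ I3]), (4, [VZ I2]), (2, [VZ I3]), (3, [VZ I3]), (2, [VT]), (4, [VT]), (8, [VT])]"])
    (simp_all add: segre.matrix_defs upt_rec lookup_add lookup_Var_exponent all_var)
  subgoal by (rule constants_independent_by_witnesses[where ws =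
      "[(0, [VZ I2, VZ I3])]"])
    (simp_all add: segre.matrix_defs upt_rec lookup_add lookup_Var_exponent all_var)
  done

section \<open>The explicit complex and chain map\<close>

definition segre_rank :: "nat \<Rightarrow> nat" where
  "segre_rank i = length (segre_shifts i)"

definition segre_diff :: "nat \<Rightarrow> 'k::field R mat" where
  "segre_diff i =
    (if i = 1 then mat_of_cols_list 1 segre.quadrics
     else if i = 2 then mat_of_cols_list 9 segre.syz1
     else if i = 3 then mat_of_cols_list 16 segre.syz2
     else if i = 4 then mat_of_cols_list 9 segre.syz3
     else 0\<^sub>m (segre_rank (i - 1)) 0)"

text \<open>The argument \<open>e\<close> carries the weights of the nullhomotopy, which select the subset of \<open>Q\<close>.\<close>

definition frob_lift :: "(idx \<Rightarrow> 'k::field R) \<Rightarrow> nat \<Rightarrow> 'k R mat" where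
  "frob_lift e i =
    (if i = 0 then 1\<^sub>m 1
     else if i = 1 then mat_of_cols_list 9 segre.lift1
     else if i = 2 then mat_of_cols_list 16 segre.lift2
     else if i = 3 then mat_of_cols_list 9 (segre.lift3_shifted (e I1) (e I2) (e I3))
     else if i = 4 then mat_of_cols_list 1 [[segre.top_form (e I1) (e I2) (e I3)]]
     else 0\<^sub>m 0 0)"

definition diff_degree :: "nat \<Rightarrow> nat" where
  "diff_degree i = (if i = 0 \<or> i = 3 then 2 else 1)"

lemma segre_rank_simps: "segre_rank 0 = 1" "segre_rank (Suc 0) = 9"
  "segre_rank 2 = 16" "segre_rank (Suc (Suc 0)) = 16"
  "segre_rank (Suc (Suc (Suc 0))) = 9"
  "segre_rank 3 = 9" "segre_rank 4 = 1" "4 < i \<Longrightarrow> segre_rank i = 0"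
  by (simp_all add: segre_rank_def segre_shifts_def)

lemma nat_cases_4:
  obtains "i = 0" | "i = Suc 0" | "i = 2" | "i = 3" | "i = (4::nat)" | "4 < i"
  by linarith

lemma length_segre:
  "length segre.quadrics = 9" "length segre.syz1 = 16" "length segre.syz2 = 9"
  "length segre.syz3 = 1" "length segre.lift1 = 9" "length segre.lift2 = 16"
  "length (segre.lift3_shifted e1 e2 e3) = 9"
  by (simp_all add: segre.matrix_defs)

lemma segre_diff_carrier: "segre_diff (Suc i) \<in> carrier_mat (segre_rank i) (segre_rank (Suc i))"
  by (cases i rule: nat_cases_4)
    (simp_all add: segre_diff_def segre_rank_simps length_segre carrier_mat_of_cols_list)

lemma frob_lift_carrier: "frob_lift e i \<in> carrier_mat (segre_rank i) (segre_rank i)"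
  by (cases i rule: nat_cases_4)
    (simp_all add: frob_lift_def segre_rank_simps length_segre carrier_mat_of_cols_list)

lemma segre_diff_homogeneous: "homogeneous_mat (diff_degree i) (segre_diff (Suc i))"
proof (cases i rule: nat_cases_4)
  case 5
  then show ?thesis by (simp add: segre_diff_def homogeneous_mat_def)
next
  case 6
  then show ?thesis by (simp add: segre_diff_def homogeneous_mat_def)
qed (simp_all add: segre_diff_def diff_degree_def homogeneous_mat_of_cols_list
      homogeneous_segre[unfolded One_nat_def])

lemma segre_diff_constants_independent: "constants_independent (segre_diff (Suc i))"
proof (cases i rule: nat_cases_4)
  case 5
  then show ?thesis by (auto simp: segre_diff_def constants_independent_def)
next
  case 6
  then show ?thesis by (auto simp: segre_diff_def constants_independent_def)
qed (simp_all add: segre_diff_def constants_independent_segre[unfolded One_nat_def])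

lemma mat_of_cols_list_replicate_0:
  "mat_of_cols_list n (replicate m (replicate n 0)) = 0\<^sub>m n m"
  by (intro eq_matI) (simp_all add: mat_of_cols_list_def)

lemma segre_complex:
  assumes two: "(2 :: 'k::field R) = 0"
  shows "(segre_diff (Suc i) * segre_diff (Suc (Suc i)) :: 'k R mat) =
    0\<^sub>m (segre_rank i) (segre_rank (Suc (Suc i)))"
proof (cases i rule: nat_cases_4)
  interpret char2_cube "X :: 'k R" T "Y I1" "Y I2" "Y I3" "Z I1" "Z I2" "Z I3"
    using two by unfold_locales
  have l: "\<And>c. c \<in> set segre.quadrics \<Longrightarrow> length c = 1" "\<And>c. c \<in> set segre.syz1 \<Longrightarrow> length c = 9"
     "\<And>c. c \<in> set segre.syz2 \<Longrightarrow> length c = 16" "\<And>c. c \<in> set segre.syz3 \<Longrightarrow> length c = 9"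
    using homogeneous_segre by auto
  {
    case 1
    have "(mat_of_cols_list 1 segre.quadrics * mat_of_cols_list 9 segre.syz1 :: 'k R mat) = 0\<^sub>m 1 16"
      by (subst mult_mat_of_cols_list) (use l quadrics_syz1 mat_of_cols_list_replicate_0[of 1 16] in
        \<open>auto simp: length_segre\<close>)
    with 1 show ?thesis by (simp add: segre_diff_def segre_rank_simps)
  next
    case 2
    have "(mat_of_cols_list 9 segre.syz1 * mat_of_cols_list 16 segre.syz2 :: 'k R mat) = 0\<^sub>m 9 9"
      by (subst mult_mat_of_cols_list) (use l syz1_syz2 mat_of_cols_list_replicate_0[of 9 9] in
        \<open>auto simp: length_segre\<close>)
    with 2 show ?thesis by (simp add: segre_diff_def segre_rank_simps)
  next
    case 3
    have "(mat_of_cols_list 16 segre.syz2 * mat_of_cols_list 9 segre.syz3 :: 'k R mat) = 0\<^sub>m 16 1"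
      by (subst mult_mat_of_cols_list) (use l syz2_syz3 mat_of_cols_list_replicate_0[of 16 1] in
        \<open>auto simp: length_segre\<close>)
    with 3 show ?thesis by (simp add: segre_diff_def segre_rank_simps)
  next
    case 4
    then show ?thesis using segre_diff_carrier[of 3, where ?'a='k]
      by (intro eq_matI) (auto simp: segre_diff_def segre_rank_simps)
  next
    case 5
    then show ?thesis by (intro eq_matI) (auto simp: segre_diff_def segre_rank_simps)
  next
    case 6
    then show ?thesis by (intro eq_matI) (auto simp: segre_diff_def segre_rank_simps)
  }
qed

lemma frob_lift_square:
  fixes e :: "idx \<Rightarrow> 'k::field R"
  assumes two: "(2 :: 'k R) = 0" and e: "e I1 + e I2 + e I3 = 1"
  shows "frob_lift e i * map_mat (\<lambda>p. p^2) (segre_diff (Suc i)) =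
    segre_diff (Suc i) * frob_lift e (Suc i)"
proof (cases i rule: nat_cases_4)
  interpret char2_cube "X :: 'k R" T "Y I1" "Y I2" "Y I3" "Z I1" "Z I2" "Z I3"
    using two by unfold_locales
  let ?s = "map_mat (\<lambda>p :: 'k R. p^2)"
  let ?l3 = "segre.lift3_shifted (e I1) (e I2) (e I3)"
  have l: "\<forall>c\<in>set segre.quadrics. length c = 1" "\<forall>c\<in>set segre.syz1. length c = 9"
     "\<forall>c\<in>set segre.syz2. length c = 16" "\<forall>c\<in>set segre.syz3. length c = 9"
     "\<forall>c\<in>set segre.lift1. length c = 9" "\<forall>c\<in>set segre.lift2. length c = 16"
    using homogeneous_segre by auto
  have l3: "\<forall>c\<in>set ?l3. length c = 9" by (simp add: segre.matrix_defs)
  {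
    case 1
    have "?s (mat_of_cols_list 1 segre.quadrics) =
        mat_of_cols_list 1 segre.quadrics * mat_of_cols_list 9 segre.lift1"
      using lift1_square by (simp add: map_mat_of_cols_list mult_mat_of_cols_list l length_segre)
    moreover have "1\<^sub>m 1 * ?s (mat_of_cols_list 1 segre.quadrics) = ?s (mat_of_cols_list 1 segre.quadrics)"
      by (rule left_mult_one_mat[of _ 1 9]) (simp add: carrier_mat_of_cols_list length_segre)
    ultimately show ?thesis
      using 1 by (simp add: frob_lift_def segre_diff_def)
  next
    case 2
    have "mat_of_cols_list 9 segre.lift1 * ?s (mat_of_cols_list 9 segre.syz1) =
        mat_of_cols_list 9 segre.syz1 * mat_of_cols_list 16 segre.lift2"
      using lift2_square by (simp add: map_mat_of_cols_list mult_mat_of_cols_list l length_segre)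
    then show ?thesis using 2 by (simp add: frob_lift_def segre_diff_def)
  next
    case 3
    have "mat_of_cols_list 16 segre.lift2 * ?s (mat_of_cols_list 16 segre.syz2) =
        mat_of_cols_list 16 segre.syz2 * mat_of_cols_list 9 ?l3"
      using lift3_square[of "e I1" "e I2" "e I3"]
      by (simp add: map_mat_of_cols_list mult_mat_of_cols_list l l3 length_segre)
    then show ?thesis using 3 by (simp add: frob_lift_def segre_diff_def)
  next
    case 4
    have "mat_of_cols_list 9 ?l3 * ?s (mat_of_cols_list 9 segre.syz3) =
        mat_of_cols_list 9 segre.syz3 * mat_of_cols_list 1 [[segre.top_form (e I1) (e I2) (e I3)]]"
      using lift4_square[OF e]
      by (simp add: map_mat_of_cols_list mult_mat_of_cols_list l l3 length_segre)
    then show ?thesis using 4 by (simp add: frob_lift_def segre_diff_def)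
  next
    case 5
    then show ?thesis using frob_lift_carrier[of e 4]
      by (intro eq_matI) (auto simp: frob_lift_def segre_diff_def segre_rank_simps)
  next
    case 6
    then show ?thesis
      by (intro eq_matI) (auto simp: frob_lift_def segre_diff_def segre_rank_simps)
  }
qed

lemma frob_lift_homogeneous:
  assumes "\<And>i. homogeneous 0 (e i)"
  shows "homogeneous_mat 0 (frob_lift e 0)" "homogeneous_mat 2 (frob_lift e 1)"
    "homogeneous_mat 3 (frob_lift e 2)" "homogeneous_mat 4 (frob_lift e 3)"
    "homogeneous_mat 6 (frob_lift e 4)"
proof -
  show "homogeneous_mat 0 (frob_lift e 0)"
    using homogeneous_Const[of 1] by (simp add: frob_lift_def homogeneous_mat_def Const.hom_one)
  show "homogeneous_mat 2 (frob_lift e 1)" "homogeneous_mat 3 (frob_lift e 2)"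
    "homogeneous_mat 4 (frob_lift e 3)"
    using homogeneous_mat_of_cols_list[OF homogeneous_segre(5)]
      homogeneous_mat_of_cols_list[OF homogeneous_segre(6)]
      homogeneous_mat_of_cols_list[OF homogeneous_segre_shifted(1)[OF assms assms assms]]
    by (simp_all add: frob_lift_def)
  show "homogeneous_mat 6 (frob_lift e 4)"
    using homogeneous_segre_shifted(2)[OF assms assms assms]
    by (simp add: frob_lift_def homogeneous_mat_def mat_of_cols_list_def)
qed

lemma H0_eq_top_form:
  fixes S :: "'k::field R set"
  assumes "(2 :: 'k R) = 0" "S \<subseteq> Q" "odd (card S)"
  obtains e :: "idx \<Rightarrow> 'k R" where "\<And>i. homogeneous 0 (e i)" "e I1 + e I2 + e I3 = 1"
    "H0 S = segre.top_form (e I1) (e I2) (e I3)"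
proof -
  obtain e :: "idx \<Rightarrow> 'k R" where e: "\<And>i. homogeneous 0 (e i)" "e I1 + e I2 + e I3 = 1"
    and sum: "(\<Sum>u\<in>S. u) = e I1 * (X * Y I1 ^ 2 * Z I1 ^ 2 * T) +
      e I2 * (X * Y I2 ^ 2 * Z I2 ^ 2 * T) + e I3 * (X * Y I3 ^ 2 * Z I3 ^ 2 * T)"
    using sum_subset_Q[OF assms] by blast
  have "H0 S = segre.top_form (e I1) (e I2) (e I3)"
    unfolding H0_def sum segre.top_form_def
    by (simp add: etas_eq_monomials sum_orbit power2_eq_square mult_ac add_ac)
  with e that show ?thesis by blast
qed

lemma frob_Const: "map_mat (\<lambda>p. p^2) (map_mat Const C) = map_mat Const (map_mat (\<lambda>c. c^2) C)"
  by (intro eq_matI) (simp_all add: power2_eq_square Const.hom_mult)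

lemma span_base_R: "p \<in> A \<Longrightarrow> p \<in> module.span (*) (A :: 'k::field R set)"
proof -
  interpret module "(*) :: 'k R \<Rightarrow> 'k R \<Rightarrow> 'k R"
    by unfold_locales (simp_all add: algebra_simps)
  show "p \<in> A \<Longrightarrow> p \<in> span A" by (rule span_base)
qed

section \<open>Transport to an arbitrary minimal resolution\<close>

theorem proposition7p5:
  fixes d :: "nat \<Rightarrow> 'k::field R mat" and S :: "'k R set"
  assumes "CHAR('k) = 2"
    and "S \<subseteq> Q" and "odd (card S)"
    and "minimal_graded_free_resolution segre_ideal segre_shifts d"
  shows "\<exists>\<Phi> e. graded_chain_map (frob_shifts segre_shifts) (frob_diff d) segre_shifts d \<Phi> \<and>
           \<Phi> 0 = 1\<^sub>m 1 \<and>
           homogeneous_basis_vec e \<and>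
           \<Phi> 4 *\<^sub>v frob_vec e = H0 S \<cdot>\<^sub>v e"
proof -
  have "(2 :: 'k) = 0" using of_nat_CHAR[where ?'a='k] assms(1) by simp
  then have two: "(2 :: 'k R) = 0" using single_numeral[of "num.Bit0 num.One", where ?'b='k]
    by (metis single_zero)
  then have uminus: "a - b = a + b" for a b :: "'k R"
    by (metis add.inverse_unique diff_conv_add_uminus mult_2 mult_zero_left)
  have frob: "semiring_hom (\<lambda>p :: 'k R. p^2)"
    by unfold_locales (simp_all add: power2_sum power_mult_distrib two)
  let ?n = segre_rank
  have res: "graded_map (segre_shifts (Suc i)) (segre_shifts i) (d (Suc i))"
      "mat_kernel (d (Suc i)) = mat_image (d (Suc (Suc i)))"
      "mat_image (d 1) = {v \<in> carrier_vec 1. v $ 0 \<in> segre_ideal}" for i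
    using assms(4) unfolding minimal_graded_free_resolution_def graded_free_resolution_def by auto
  have d: "d (Suc i) \<in> carrier_mat (?n i) (?n (Suc i))" for i
    using res(1)[of i] by (simp add: graded_map_def segre_rank_def)
  have dh: "homogeneous_mat (diff_degree i) (d (Suc i))" for i
  proof (cases "i \<le> 3")
    case True
    then have "i = 0 \<or> i = 1 \<or> i = 2 \<or> i = 3" by linarith
    then show ?thesis using res(1)[of i]
      by (auto simp: segre_shifts_def graded_map_replicate diff_degree_def
          graded_map_replicate[where r=1, simplified] graded_map_replicate[where n=1, simplified])
  next
    case False
    then show ?thesis using d[of i] by (simp add: homogeneous_mat_def segre_rank_simps)
  qed
  have aug: "col (segre_diff 1) j \<in> mat_image (d 1)" if "j < ?n 1" for j
  proof -
    have "\<forall>c\<in>set (segre.quadrics :: 'k R list list). c ! 0 \<in> segre_gens"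
      by (simp add: segre.quadrics_def segre_gens_def uminus)
    then have "(segre.quadrics ! j ! 0 :: 'k R) \<in> segre_ideal"
      using that by (auto simp: segre_ideal_def segre_rank_simps length_segre intro!: span_base_R)
    then show ?thesis unfolding res(3) using that
      by (simp add: segre_diff_def mat_of_cols_list_def segre_rank_simps length_segre)
  qed
  obtain B C :: "nat \<Rightarrow> 'k mat" where B0: "B 0 = 1\<^sub>m (?n 0)"
    and BC: "\<And>i. B i \<in> carrier_mat (?n i) (?n i)" "\<And>i. C i \<in> carrier_mat (?n i) (?n i)"
      "\<And>i. B i * C i = 1\<^sub>m (?n i)" "\<And>i. C i * B i = 1\<^sub>m (?n i)"
    and dB: "\<And>i. d (Suc i) * map_mat Const (B (Suc i)) = map_mat Const (B i) * segre_diff (Suc i)"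
    using constant_iso_of_complexes[OF d dh res(2) segre_diff_carrier segre_diff_homogeneous
        segre_diff_constants_independent segre_complex[OF two] aug] by blast
  obtain e :: "idx \<Rightarrow> 'k R" where e: "\<And>i. homogeneous 0 (e i)" "e I1 + e I2 + e I3 = 1"
    and H: "H0 S = segre.top_form (e I1) (e I2) (e I3)"
    using H0_eq_top_form[OF two assms(2,3)] by blast
  \<comment> \<open>The twist squares the entries of the inverse, so that the last map is \<open>H0 S\<close> times \<open>b c\<^sup>2\<close>
    with \<open>b c = 1\<close>. In the basis \<open>b\<close>, whose twist is \<open>b\<^sup>2\<close>, the factor becomes 1.\<close>
  define \<Phi> where "\<Phi> i = map_mat Const (B i) * frob_lift e i *
      map_mat (\<lambda>p. p^2) (map_mat Const (C i))" for i
  have hom_inv: "map_mat Const (C i) * map_mat Const (B i) = 1\<^sub>m (?n i)"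
      "map_mat Const (B i) * map_mat Const (C i) = 1\<^sub>m (?n i)" for i
    using BC[of i] by (metis Const.mat_hom_mult Const.mat_hom_one)+
  have \<Phi>_carrier: "\<Phi> i \<in> carrier_mat (?n i) (?n i)" for i
    unfolding \<Phi>_def
    by (rule mult_carrier_mat[OF mult_carrier_mat[OF _ frob_lift_carrier]]) (simp_all add: BC)
  have \<Phi>_hom: "homogeneous_mat k (\<Phi> i)" if "homogeneous_mat k (frob_lift e i)" for i k
  proof -
    have "homogeneous_mat (0 + k + 0) (\<Phi> i)" unfolding \<Phi>_def frob_Const
      using BC[of i] frob_lift_carrier[of e i] that
      by (intro homogeneous_mat_mult homogeneous_mat_Const) auto
    then show ?thesis by simp
  qed
  have "\<Phi> i * frob_diff d (Suc i) = d (Suc i) * \<Phi> (Suc i)" for i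
    unfolding \<Phi>_def frob_diff_def
    by (rule transport_square[OF frob d segre_diff_carrier _ _ hom_inv(1) _ _ hom_inv(2)
          frob_lift_carrier frob_lift_carrier dB frob_lift_square[OF two e(2)]])
      (simp_all add: BC)
  moreover have "graded_map (frob_shifts segre_shifts i) (segre_shifts i) (\<Phi> i)" for i
  proof (cases i rule: nat_cases_4)
    case 6
    then show ?thesis using \<Phi>_carrier[of i]
      by (simp add: graded_map_def frob_shifts_def segre_shifts_def segre_rank_simps)
  qed (use \<Phi>_carrier[of i] frob_lift_homogeneous[OF e(1), THEN \<Phi>_hom] in
      \<open>simp_all add: frob_shifts_def segre_shifts_def segre_rank_simps graded_map_replicate
        graded_map_replicate[where r=1 and n=1, simplified]\<close>)
  ultimately have "graded_chain_map (frob_shifts segre_shifts) (frob_diff d) segre_shifts d \<Phi>"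
    by (simp add: graded_chain_map_def)
  moreover have "\<Phi> 0 = 1\<^sub>m 1"
  proof -
    have "C 0 = 1\<^sub>m 1" using BC(2,3)[of 0] B0 by (simp add: segre_rank_simps)
    then show ?thesis using B0
      by (simp add: \<Phi>_def frob_lift_def segre_rank_simps Const.mat_hom_one
          semiring_hom.mat_hom_one[OF frob])
  qed
  moreover
  define b c where "b = B 4 $$ (0, 0)" and "c = C 4 $$ (0, 0)"
  define v where "v = vec 1 (\<lambda>_. Const b)"
  have bc: "b * c = 1"
  proof -
    have "(B 4 * C 4) $$ (0, 0) = b * c"
      using BC(1,2)[of 4] by (simp add: segre_rank_simps scalar_prod_def b_def c_def)
    then show ?thesis using BC(3)[of 4] by (simp add: segre_rank_simps)
  qed
  have "homogeneous_basis_vec v"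
    unfolding homogeneous_basis_vec_def
  proof (intro conjI ballI)
    fix w :: "'k R vec" assume w: "w \<in> carrier_vec 1"
    have bcR: "Const b * Const c = 1" using bc by (metis Const.hom_mult Const.hom_one)
    show "\<exists>!r. w = r \<cdot>\<^sub>v v"
    proof (rule ex1I[of _ "w $ 0 * Const c"])
      show "w = (w $ 0 * Const c) \<cdot>\<^sub>v v"
        using w bcR[THEN arg_cong, of "\<lambda>p. w $ 0 * p"]
        by (intro eq_vecI) (auto simp: v_def mult_ac)
      fix r assume "w = r \<cdot>\<^sub>v v"
      then have "w $ 0 = r * Const b" by (simp add: v_def)
      then show "r = w $ 0 * Const c" using bcR by (simp add: mult.assoc)
    qed
  qed (simp_all add: v_def)
  moreover have "\<Phi> 4 *\<^sub>v frob_vec v = H0 S \<cdot>\<^sub>v v"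
  proof -
    have "\<Phi> 4 $$ (0, 0) = Const b * H0 S * Const c ^ 2"
      using BC(1,2)[of 4] by (simp add: \<Phi>_def frob_lift_def H mat_of_cols_list_def
          scalar_prod_def segre_rank_simps b_def c_def)
    then have "(\<Phi> 4 *\<^sub>v frob_vec v) $ 0 = Const b * H0 S * Const c ^ 2 * Const b ^ 2"
      using \<Phi>_carrier[of 4] by (simp add: frob_vec_def v_def segre_rank_simps scalar_prod_def)
    also have "\<dots> = H0 S * Const b * (Const (b * c)) ^ 2"
      by (simp add: Const.hom_mult power2_eq_square mult_ac)
    also have "\<dots> = (H0 S \<cdot>\<^sub>v v) $ 0" by (simp add: bc Const.hom_one v_def)
    finally show ?thesis using \<Phi>_carrier[of 4]
      by (intro eq_vecI) (auto simp: segre_rank_simps v_def)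
  qed
  ultimately show ?thesis by blast
qed

end
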